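(* Let $p_1$ be any mesh pattern, and let $p$ be the mesh pattern obtained from the mesh pattern $(12,\{(0,1),(0,2),(1,1),(1,2),(2,0),(2,2)\})$ by inserting $p_1$ in the box $(2,1)$. Then $$A_p(x)=F(x)-x\big(F(x)-1\big)\big(F(x)-A_{p_1}(x)\big),$$ $$F_p(x,q)=F(x)+x\big(F(x)-1\big)\big(F_{p_1}(x,q)-F(x)\big).$$
   Context: $S_n$ is the set of permutations of $\{1,\dots,n\}$, $n\ge 0$ ($S_0$ consists of the empty permutation). A mesh pattern of length $k$ is a pair $(\tau,R)$ with $\tau\in S_k$ and $R\subseteq\{0,\dots,k\}\times\{0,\dots,k\}$ (the shaded boxes). Given $\pi=\pi_1\cdots\pi_n\in S_n$ and positions $i_1<\dots<i_k$, let $v_1<\dots<v_k$ be the values $\pi_{i_1},\dots,\pi_{i_k}$ sorted increasingly, and put $i_0=v_0=0$, $i_{k+1}=v_{k+1}=n+1$. The box $(r,s)$ contains the elements $\pi_j$ with $i_r<j<i_{r+1}$ and $v_s<\pi_j<v_{s+1}$. The subsequence $\pi_{i_1}\cdots\pi_{i_k}$ is an occurrence of $(\tau,R)$ if it is order-isomorphic to $\tau$ and every box in $R$ contains no element of $\pi$. The empty pattern ($k=0$, $R=\emptyset$) is allowed and has exactly one occurrence in every permutation. Insertion of patterns: if mesh patterns are inserted in some unshaded boxes of a base mesh pattern, an occurrence of the resulting mesh pattern in $\pi$ consists of an occurrence of the base pattern in $\pi$ together with, for each inserted pattern, an occurrence of it in the permutation order-isomorphic to the sequence of all elements of $\pi$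 lying in the corresponding box (unshaded boxes in which nothing is inserted are unrestricted). For a mesh pattern $p$, $p(\pi)$ is the number of occurrences of $p$ in $\pi$, $F_p(x,q)=\sum_{n\ge0}x^n\sum_{\pi\in S_n}q^{p(\pi)}$, $A_p(x)=\sum_{n\ge 0}x^n\,|\{\pi\in S_n: p(\pi)=0\}|$, and $F(x)=\sum_{n\ge0}n!\,x^n$. All are formal power series. *)

theory Defs
  imports
    "HOL-Combinatorics.Permutations"
    "HOL-Computational_Algebra.Polynomial"
    "HOL-Computational_Algebra.Formal_Power_Series"
begin

text \<open>
  A permutation of length \<open>n\<close> is a function \<open>\<pi>\<close> with \<open>\<pi> permutes {1..n}\<close>; the one-line
  notation is \<open>\<pi> 1, \<dots>, \<pi> n\<close>.  A pattern has a length, a permutation of that length, and a set of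
  shaded boxes (column, row).
\<close>

datatype mesh_pattern =
  Mesh (mp_length: nat) (mp_perm: "nat \<Rightarrow> nat") (mp_shaded: "(nat \<times> nat) set")

definition is_mesh_pattern :: "mesh_pattern \<Rightarrow> bool" where
  "is_mesh_pattern p \<longleftrightarrow>
     mp_perm p permutes {1..mp_length p} \<and> mp_shaded p \<subseteq> {0..mp_length p} \<times> {0..mp_length p}"

text \<open>
  For \<open>A = {a\<^sub>1 < \<dots> < a\<^sub>k}\<close>, \<open>gridline n A r\<close> is \<open>a\<^sub>r\<close>, with \<open>a\<^sub>0 = 0\<close> and
  \<open>a\<^bsub>k+1\<^esub> = n + 1\<close>.
\<close>

definition gridline :: "nat \<Rightarrow> nat set \<Rightarrow> nat \<Rightarrow> nat" where
  "gridline n A r = (0 # sorted_list_of_set A @ [n + 1]) ! r"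

text \<open>The positions of the elements of \<open>\<pi>\<close> in a box, relative to the positions \<open>I\<close>.\<close>

definition mesh_box :: "nat \<Rightarrow> (nat \<Rightarrow> nat) \<Rightarrow> nat set \<Rightarrow> nat \<times> nat \<Rightarrow> nat set" where
  "mesh_box n \<pi> I = (\<lambda>(r, s). {j \<in> {1..n}.
     gridline n I r < j \<and> j < gridline n I (r + 1) \<and>
     gridline n (\<pi> ` I) s < \<pi> j \<and> \<pi> j < gridline n (\<pi> ` I) (s + 1)})"

text \<open>An occurrence is represented by its set of positions.\<close>

definition occurrences :: "mesh_pattern \<Rightarrow> nat \<Rightarrow> (nat \<Rightarrow> nat) \<Rightarrow> nat set set" where
  "occurrences p n \<pi> = {I. I \<subseteq> {1..n} \<and> card I = mp_length p \<and>
     (\<forall>x\<in>{1..mp_length p}. \<forall>y\<in>{1..mp_length p}.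
        \<pi> (gridline n I x) < \<pi> (gridline n I y) \<longleftrightarrow> mp_perm p x < mp_perm p y) \<and>
     (\<forall>c\<in>mp_shaded p. mesh_box n \<pi> I c = {})}"

definition mesh_count :: "mesh_pattern \<Rightarrow> nat \<Rightarrow> (nat \<Rightarrow> nat) \<Rightarrow> nat" where
  "mesh_count p n \<pi> = card (occurrences p n \<pi>)"

text \<open>
  Inserting a pattern of length \<open>m\<close> in the box \<open>(a, b)\<close> replaces column \<open>a\<close> and row \<open>b\<close> by
  \<open>m + 1\<close> columns and \<open>m + 1\<close> rows.  The function \<open>coarsen a m\<close> sends a new column (row) to the
  old one that contains it, and \<open>insert_perm\<close> is the permutation of the resulting pattern in
  one-line notation.  A new box is shaded if the old box containing it is shaded, or if it is a
  shaded box of the inserted pattern.  The theorem \<open>bij_betw_occurrences_mesh_insert\<close> below confirms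
  that an occurrence of the result is an occurrence of the base pattern together with an occurrence
  of the inserted pattern among the elements in the box.
\<close>

definition coarsen :: "nat \<Rightarrow> nat \<Rightarrow> nat \<Rightarrow> nat" where
  "coarsen a m r = (if r \<le> a then r else if r \<le> a + m then a else r - m)"

definition insert_perm ::
    "nat \<Rightarrow> (nat \<Rightarrow> nat) \<Rightarrow> nat \<times> nat \<Rightarrow> nat \<Rightarrow> (nat \<Rightarrow> nat) \<Rightarrow> nat \<Rightarrow> nat" where
  "insert_perm k \<tau> = (\<lambda>(a, b) m \<sigma> x.
     let lift = (\<lambda>v. if v \<le> b then v else v + m)
     in if x \<le> a then lift (\<tau> x)
        else if x \<le> a + m then b + \<sigma> (x - a)
        else if x \<le> k + m then lift (\<tau> (x - m))
        else x)"

definition mesh_insert :: "mesh_pattern \<Rightarrow> nat \<times> nat \<Rightarrow> mesh_pattern \<Rightarrow> mesh_pattern" where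
  "mesh_insert p = (\<lambda>(a, b) q.
     let k = mp_length p; m = mp_length q
     in Mesh (k + m) (insert_perm k (mp_perm p) (a, b) m (mp_perm q))
          {(r, s). r \<le> k + m \<and> s \<le> k + m \<and>
             ((coarsen a m r, coarsen b m s) \<in> mp_shaded p \<or>
              r \<in> {a..a + m} \<and> s \<in> {b..b + m} \<and> (r - a, s - b) \<in> mp_shaded q)})"

text \<open>
  The series \<open>F(x)\<close>, \<open>F\<^sub>p(x, q)\<close> and \<open>A\<^sub>p(x)\<close>.  In \<open>F\<^sub>p\<close>, each coefficient of \<open>x\<^sup>n\<close> is a
  polynomial in \<open>q\<close>, and \<open>monom 1 i\<close> is \<open>q\<^sup>i\<close>.
\<close>

definition F_series :: "'a::semiring_char_0 fps" where
  "F_series = Abs_fps (\<lambda>n. fact n)"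

definition F_pat :: "mesh_pattern \<Rightarrow> int poly fps" where
  "F_pat p = Abs_fps (\<lambda>n. \<Sum>\<pi> | \<pi> permutes {1..n}. monom 1 (mesh_count p n \<pi>))"

definition A_pat :: "mesh_pattern \<Rightarrow> int fps" where
  "A_pat p = Abs_fps (\<lambda>n. int (card {\<pi>. \<pi> permutes {1..n} \<and> mesh_count p n \<pi> = 0}))"

text \<open>
  The permutation order-isomorphic to the sequence of the elements of \<open>\<pi>\<close> at the positions \<open>B\<close>,
  where \<open>nth_position B x\<close> is the \<open>x\<close>-th smallest position in \<open>B\<close>, counted from 1.
\<close>

definition nth_position :: "nat set \<Rightarrow> nat \<Rightarrow> nat" where
  "nth_position B x = sorted_list_of_set B ! (x - 1)"

definition standardize :: "(nat \<Rightarrow> nat) \<Rightarrow> nat set \<Rightarrow> nat \<Rightarrow> nat" where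
  "standardize \<pi> B x =
     (if x \<in> {1..card B} then card {w \<in> \<pi> ` B. w \<le> \<pi> (nth_position B x)} else x)"

text \<open>
  For the proof of \<open>bij_betw_occurrences_mesh_insert\<close>, occurrences are described by ranks: an element
  \<open>j \<notin> I\<close> lies in the box \<open>(below I j, below (\<pi> ` I) (\<pi> j))\<close>.
\<close>

definition below :: "nat set \<Rightarrow> nat \<Rightarrow> nat" where
  "below A x = card {y \<in> A. y < x}"

lemma below_le_card: "finite A \<Longrightarrow> below A x \<le> card A"
  unfolding below_def by (rule card_mono) auto

lemma below_mono: "finite A \<Longrightarrow> x \<le> y \<Longrightarrow> below A x \<le> below A y"
  unfolding below_def by (rule card_mono) auto

lemma below_strict: "finite A \<Longrightarrow> x \<in> A \<Longrightarrow> x < y \<Longrightarrow> below A x < below A y"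
  unfolding below_def by (rule psubset_card_mono) auto

lemma below_less_iff:
  "finite A \<Longrightarrow> x \<in> A \<Longrightarrow> y \<in> A \<Longrightarrow> below A x < below A y \<longleftrightarrow> x < y"
  by (meson below_strict below_mono not_le)

lemma below_inj: "finite A \<Longrightarrow> x \<in> A \<Longrightarrow> y \<in> A \<Longrightarrow> below A x = below A y \<Longrightarrow> x = y"
  by (metis below_strict less_irrefl linorder_neqE_nat)

lemma below_less_card: "finite A \<Longrightarrow> x \<in> A \<Longrightarrow> below A x < card A"
  unfolding below_def by (rule psubset_card_mono) auto

lemma below_Un_disjoint:
  "finite A \<Longrightarrow> finite B \<Longrightarrow> A \<inter> B = {} \<Longrightarrow> below (A \<union> B) x = below A x + below B x"
proof -
  assume "finite A" "finite B" "A \<inter> B = {}"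
  moreover have "{y \<in> A \<union> B. y < x} = {y \<in> A. y < x} \<union> {y \<in> B. y < x}" by auto
  ultimately show ?thesis
    unfolding below_def by (simp add: card_Un_disjoint disjoint_iff)
qed

lemma bij_betw_below:
  assumes "finite A" shows "bij_betw (below A) A {..<card A}"
proof -
  have inj: "inj_on (below A) A" using assms below_inj by (auto intro: inj_onI)
  have "below A ` A \<subseteq> {..<card A}" using assms below_less_card by auto
  then have "below A ` A = {..<card A}"
    using card_image[OF inj] by (intro card_subset_eq) auto
  then show ?thesis using inj by (simp add: bij_betw_def)
qed

lemma below_nth:
  assumes "finite A" "r < card A"
  shows "below A (sorted_list_of_set A ! r) = r"
proof -
  let ?xs = "sorted_list_of_set A"
  have s: "sorted_wrt (<) ?xs" and l: "length ?xs = card A" and st: "set ?xs = A"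
    using assms by auto
  have "{y \<in> A. y < ?xs ! r} = (!) ?xs ` {..<r}"
  proof (intro equalityI subsetI)
    fix y assume "y \<in> {y \<in> A. y < ?xs ! r}"
    then have "y \<in> set ?xs" "y < ?xs ! r" using st by auto
    then obtain i where i: "i < card A" "y = ?xs ! i" "?xs ! i < ?xs ! r"
      using l by (metis in_set_conv_nth)
    then have "i < r" using s l assms(2)
      by (metis linorder_neqE_nat less_asym less_irrefl sorted_wrt_nth_less)
    then show "y \<in> (!) ?xs ` {..<r}" using i by auto
  next
    fix y assume "y \<in> (!) ?xs ` {..<r}"
    then obtain i where i: "i < r" "y = ?xs ! i" by auto
    then have "y < ?xs ! r" using sorted_wrt_nth_less[OF s] l assms(2) by simp
    moreover have "y \<in> set ?xs" using i l assms(2) by simp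
    ultimately show "y \<in> {y \<in> A. y < ?xs ! r}" using st by simp
  qed
  moreover have "inj_on ((!) ?xs) {..<r}"
    using assms l by (auto intro!: inj_on_nth)
  ultimately show ?thesis unfolding below_def by (simp add: card_image)
qed

lemma nth_position_in: "finite A \<Longrightarrow> x \<in> {1..card A} \<Longrightarrow> nth_position A x \<in> A"
  unfolding nth_position_def
  by (metis One_nat_def Suc_le_eq Suc_pred' atLeastAtMost_iff length_sorted_list_of_set
      nth_mem set_sorted_list_of_set)

lemma below_nth_position:
  "finite A \<Longrightarrow> x \<in> {1..card A} \<Longrightarrow> below A (nth_position A x) = x - 1"
  unfolding nth_position_def by (rule below_nth) auto

lemma nth_position_Suc_below:
  "finite A \<Longrightarrow> x \<in> A \<Longrightarrow> nth_position A (Suc (below A x)) = x"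
  using below_inj[of A "nth_position A (Suc (below A x))" x] below_less_card[of A x]
    nth_position_in[of A "Suc (below A x)"] below_nth_position[of A "Suc (below A x)"] by auto

lemma nth_position_less_iff:
  "finite A \<Longrightarrow> x \<in> {1..card A} \<Longrightarrow> y \<in> {1..card A} \<Longrightarrow>
     nth_position A x < nth_position A y \<longleftrightarrow> x < y"
  using below_less_iff[of A "nth_position A x" "nth_position A y"]
  by (auto simp: nth_position_in below_nth_position)

lemma bij_betw_nth_position:
  assumes "finite A" shows "bij_betw (nth_position A) {1..card A} A"
proof (rule bij_betwI)
  show "nth_position A \<in> {1..card A} \<rightarrow> A" using assms nth_position_in by blast
  show "(\<lambda>x. Suc (below A x)) \<in> A \<rightarrow> {1..card A}"
    using assms below_less_card by (simp add: Pi_iff Suc_le_eq)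
  show "Suc (below A (nth_position A x)) = x" if "x \<in> {1..card A}" for x
    using that below_nth_position[OF assms that] by simp
  show "nth_position A (Suc (below A x)) = x" if "x \<in> A" for x
    using assms that by (rule nth_position_Suc_below)
qed

lemma gridline_nth_position:
  assumes "finite A" "x \<in> {1..card A}" shows "gridline n A x = nth_position A x"
  using assms by (auto simp: gridline_def nth_position_def nth_Cons' nth_append)

lemma gridline_Suc_card: "finite A \<Longrightarrow> gridline n A (Suc (card A)) = Suc n"
  by (auto simp: gridline_def nth_append)

lemma gridline_between_iff:
  assumes A: "finite A" "r \<le> card A" and j: "j \<in> {1..n}" "j \<notin> A"
  shows "gridline n A r < j \<and> j < gridline n A (r + 1) \<longleftrightarrow> below A j = r"
proof -
  have lo: "gridline n A r < j \<longleftrightarrow> r \<le> below A j"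
  proof (cases "r = 0")
    case True
    then show ?thesis using j by (simp add: gridline_def)
  next
    case False
    let ?g = "nth_position A r"
    have g: "gridline n A r = ?g" "?g \<in> A" "below A ?g = r - 1"
      using A False by (auto simp: gridline_nth_position below_nth_position intro: nth_position_in)
    show ?thesis
    proof (cases "?g < j")
      case True
      then show ?thesis using g below_strict[of A ?g j] A by auto
    next
      case F: False
      then show ?thesis using g below_mono[of A j ?g] A False by auto
    qed
  qed
  have hi: "j < gridline n A (r + 1) \<longleftrightarrow> below A j \<le> r"
  proof (cases "r = card A")
    case True
    then show ?thesis using j A below_le_card[of A j] by (simp add: gridline_Suc_card)
  next
    case False
    let ?g = "nth_position A (r + 1)"
    have g: "gridline n A (r + 1) = ?g" "?g \<in> A" "below A ?g = r"
      using A False by (auto simp: gridline_nth_position below_nth_position intro: nth_position_in)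
    show ?thesis
    proof (cases "j < ?g")
      case True
      then show ?thesis using g below_mono[of A j ?g] A by auto
    next
      case F: False
      then have "?g < j" using j g by (metis linorder_neqE_nat)
      then show ?thesis using g below_strict[of A ?g j] A by auto
    qed
  qed
  show ?thesis using lo hi by auto
qed

lemma gridline_not_between:
  assumes A: "finite A" "A \<subseteq> {1..n}" "r \<le> card A" and j: "j \<in> A"
  shows "\<not> (gridline n A r < j \<and> j < gridline n A (r + 1))"
proof
  assume *: "gridline n A r < j \<and> j < gridline n A (r + 1)"
  have "r \<le> below A j"
  proof (cases "r = 0")
    case False
    then show ?thesis
      using * A j below_strict[of A "nth_position A r" j]
        below_nth_position[of A r] nth_position_in[of A r] gridline_nth_position[of A r n] by auto
  qed auto
  moreover have "below A j < r"
  proof (cases "r = card A")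
    case True
    then show ?thesis using below_less_card A j by auto
  next
    case False
    then show ?thesis
      using * A j below_strict[of A j "nth_position A (r+1)"]
        below_nth_position[of A "r+1"] gridline_nth_position[of A "r+1" n] by auto
  qed
  ultimately show False by simp
qed

lemma mesh_box_eq:
  assumes \<pi>: "\<pi> permutes {1..n}" and I: "I \<subseteq> {1..n}" and c: "r \<le> card I" "s \<le> card I"
  shows "mesh_box n \<pi> I (r, s) =
    {j \<in> {1..n} - I. below I j = r \<and> below (\<pi> ` I) (\<pi> j) = s}"
proof -
  have fin: "finite I" using I finite_subset by blast
  have inj: "inj \<pi>" using \<pi> permutes_inj by blast
  have cI: "card (\<pi> ` I) = card I" using inj by (simp add: card_image inj_on_subset)
  have "(gridline n I r < j \<and> j < gridline n I (r + 1) \<and>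
     gridline n (\<pi> ` I) s < \<pi> j \<and> \<pi> j < gridline n (\<pi> ` I) (s + 1)) \<longleftrightarrow>
     (j \<notin> I \<and> below I j = r \<and> below (\<pi> ` I) (\<pi> j) = s)" if j: "j \<in> {1..n}" for j
  proof (cases "j \<in> I")
    case True
    then show ?thesis using gridline_not_between[of I n r j] fin I c by auto
  next
    case False
    then have "\<pi> j \<notin> \<pi> ` I" using inj by (auto dest: injD)
    moreover have "\<pi> j \<in> {1..n}" using \<pi> j by (simp only: permutes_in_image)
    ultimately show ?thesis
      using gridline_between_iff[of I r j n] gridline_between_iff[of "\<pi> ` I" s "\<pi> j" n]
        fin c cI j False by auto
  qed
  then show ?thesis unfolding mesh_box_def by auto
qed

definition occurrence_on :: "mesh_pattern \<Rightarrow> nat set \<Rightarrow> (nat \<Rightarrow> nat) \<Rightarrow> nat set \<Rightarrow> bool" where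
  "occurrence_on p B \<pi> I \<longleftrightarrow> I \<subseteq> B \<and> card I = mp_length p \<and>
     (\<forall>x\<in>I. mp_perm p (Suc (below I x)) = Suc (below (\<pi> ` I) (\<pi> x))) \<and>
     (\<forall>x\<in>B - I. (below I x, below (\<pi> ` I) (\<pi> x)) \<notin> mp_shaded p)"

lemma order_iso_iff:
  assumes \<tau>: "\<tau> permutes {1..k}" and I: "finite I" "card I = k" and inj: "inj_on \<pi> I"
  shows "(\<forall>x\<in>{1..k}. \<forall>y\<in>{1..k}.
        \<pi> (nth_position I x) < \<pi> (nth_position I y) \<longleftrightarrow> \<tau> x < \<tau> y) \<longleftrightarrow>
     (\<forall>x\<in>I. \<tau> (Suc (below I x)) = Suc (below (\<pi> ` I) (\<pi> x)))" (is "?L \<longleftrightarrow> ?R")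
proof
  assume L: ?L
  show ?R
  proof
    fix i assume i: "i \<in> I"
    define x where "x = Suc (below I i)"
    have x: "x \<in> {1..k}" using below_less_card[of I i] I i by (auto simp: x_def)
    have gx: "nth_position I x = i" using nth_position_Suc_below I i by (simp add: x_def)
    have im: "I = nth_position I ` {1..k}"
      using bij_betw_nth_position[OF I(1)] I by (simp add: bij_betw_def)
    have injg: "inj_on (nth_position I) {1..k}"
      using bij_betw_nth_position[OF I(1)] I by (simp add: bij_betw_def)
    have injc: "inj_on (\<lambda>y. \<pi> (nth_position I y)) {1..k}"
      using comp_inj_on[of "nth_position I" "{1..k}" \<pi>] inj im injg by (simp add: comp_def)
    have "{w \<in> \<pi> ` I. w < \<pi> i} = (\<lambda>y. \<pi> (nth_position I y)) ` {y \<in> {1..k}. \<tau> y < \<tau> x}"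
    proof -
      have "{w \<in> \<pi> ` I. w < \<pi> i} = {w \<in> (\<lambda>y. \<pi> (nth_position I y)) ` {1..k}. w < \<pi> i}"
        by (subst im) (simp only: image_image)
      also have "\<dots> = (\<lambda>y. \<pi> (nth_position I y)) ` {y \<in> {1..k}. \<tau> y < \<tau> x}"
        using L x gx by blast
      finally show ?thesis .
    qed
    moreover have "inj_on (\<lambda>y. \<pi> (nth_position I y)) {y \<in> {1..k}. \<tau> y < \<tau> x}"
      by (rule inj_on_subset[OF injc]) auto
    ultimately have "below (\<pi> ` I) (\<pi> i) = card {y \<in> {1..k}. \<tau> y < \<tau> x}"
      unfolding below_def by (simp only: card_image)
    also have "\<dots> = card (\<tau> ` {y \<in> {1..k}. \<tau> y < \<tau> x})"
      using permutes_inj[OF \<tau>] by (simp add: card_image inj_on_subset)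
    also have "\<tau> ` {y \<in> {1..k}. \<tau> y < \<tau> x} = {1..<\<tau> x}"
    proof -
      have tx: "\<tau> x \<in> {1..k}" using x \<tau> by (simp only: permutes_in_image)
      have "\<tau> ` {y \<in> {1..k}. \<tau> y < \<tau> x} = {z \<in> \<tau> ` {1..k}. z < \<tau> x}" by auto
      also have "\<dots> = {z \<in> {1..k}. z < \<tau> x}" using permutes_image[OF \<tau>] by simp
      also have "\<dots> = {1..<\<tau> x}" using tx by auto
      finally show ?thesis .
    qed
    also have "card {1..<\<tau> x} = \<tau> x - 1" by simp
    finally have "below (\<pi> ` I) (\<pi> i) = \<tau> x - 1" .
    moreover have "\<tau> x \<in> {1..k}" using x \<tau> by (simp only: permutes_in_image)
    ultimately show "\<tau> (Suc (below I i)) = Suc (below (\<pi> ` I) (\<pi> i))" by (simp add: x_def)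
  qed
next
  assume R: ?R
  show ?L
  proof (intro ballI)
    fix x y assume xy: "x \<in> {1..k}" "y \<in> {1..k}"
    have *: "\<tau> z = Suc (below (\<pi> ` I) (\<pi> (nth_position I z)))" "nth_position I z \<in> I"
      if "z \<in> {1..k}" for z
      using R that I nth_position_in[of I z] below_nth_position[of I z] by fastforce+
    show "\<pi> (nth_position I x) < \<pi> (nth_position I y) \<longleftrightarrow> \<tau> x < \<tau> y"
      using *[OF xy(1)] *[OF xy(2)] I
        below_less_iff[of "\<pi> ` I" "\<pi> (nth_position I x)" "\<pi> (nth_position I y)"] by simp
  qed
qed

lemma occurrences_iff:
  assumes \<pi>: "\<pi> permutes {1..n}" and p: "is_mesh_pattern p"
  shows "I \<in> occurrences p n \<pi> \<longleftrightarrow> occurrence_on p {1..n} \<pi> I"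
proof (cases "I \<subseteq> {1..n} \<and> card I = mp_length p")
  case True
  then have I: "I \<subseteq> {1..n}" "card I = mp_length p" "finite I"
    using finite_subset[of I "{1..n}"] by auto
  have inj: "inj_on \<pi> I" using permutes_inj[OF \<pi>] inj_on_subset by blast
  have 1: "(\<forall>c\<in>mp_shaded p. mesh_box n \<pi> I c = {}) \<longleftrightarrow>
     (\<forall>x\<in>{1..n} - I. (below I x, below (\<pi> ` I) (\<pi> x)) \<notin> mp_shaded p)"
  proof -
    have "mesh_box n \<pi> I c =
        {x \<in> {1..n} - I. (below I x, below (\<pi> ` I) (\<pi> x)) = c}" if "c \<in> mp_shaded p" for c
    proof -
      obtain r s where c: "c = (r, s)" by (cases c)
      then have "r \<le> card I" "s \<le> card I" using that p I unfolding is_mesh_pattern_def by auto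
      then show ?thesis using mesh_box_eq[OF \<pi> I(1)] c by auto
    qed
    then have "(\<forall>c\<in>mp_shaded p. mesh_box n \<pi> I c = {}) \<longleftrightarrow> (\<forall>c\<in>mp_shaded p.
        {x \<in> {1..n} - I. (below I x, below (\<pi> ` I) (\<pi> x)) = c} = {})"
      by simp
    then show ?thesis by blast
  qed
  have 2: "(\<forall>x\<in>{1..mp_length p}. \<forall>y\<in>{1..mp_length p}.
        \<pi> (gridline n I x) < \<pi> (gridline n I y) \<longleftrightarrow> mp_perm p x < mp_perm p y) \<longleftrightarrow>
      (\<forall>x\<in>{1..mp_length p}. \<forall>y\<in>{1..mp_length p}.
        \<pi> (nth_position I x) < \<pi> (nth_position I y) \<longleftrightarrow> mp_perm p x < mp_perm p y)"
    using I by (simp add: gridline_nth_position)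
  show ?thesis
    unfolding occurrences_def occurrence_on_def mem_Collect_eq 1 2
    using order_iso_iff[OF _ I(3,2) inj] p unfolding is_mesh_pattern_def by blast
next
  case False
  then show ?thesis unfolding occurrences_def occurrence_on_def by blast
qed

lemma below_image:
  assumes "inj_on e X" "A \<subseteq> X" "x \<in> X" "\<And>y. y \<in> X \<Longrightarrow> e y < e x \<longleftrightarrow> y < x"
  shows "below (e ` A) (e x) = below A x"
proof -
  have "{y \<in> e ` A. y < e x} = e ` {y \<in> A. y < x}" using assms by blast
  moreover have "inj_on e {y \<in> A. y < x}" by (rule inj_on_subset[OF assms(1)]) (use assms(2) in auto)
  ultimately show ?thesis unfolding below_def by (simp add: card_image)
qed

lemma standardize_less_iff:
  assumes B: "finite B" and x: "x \<in> {1..card B}" "y \<in> {1..card B}"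
  shows "standardize \<pi> B x < standardize \<pi> B y \<longleftrightarrow>
     \<pi> (nth_position B x) < \<pi> (nth_position B y)"
proof -
  have *: "standardize \<pi> B z = Suc (below (\<pi> ` B) (\<pi> (nth_position B z)))"
    if "z \<in> {1..card B}" for z
  proof -
    let ?v = "\<pi> (nth_position B z)"
    have "?v \<in> \<pi> ` B" using nth_position_in B that by blast
    then have "{w \<in> \<pi> ` B. w \<le> ?v} = insert ?v {w \<in> \<pi> ` B. w < ?v}" by auto
    then show ?thesis using that B unfolding standardize_def below_def by simp
  qed
  show ?thesis
    using x B below_less_iff[of "\<pi> ` B"] nth_position_in[of B] by (simp add: *)
qed

lemma standardize_permutes:
  assumes B: "finite B" and inj: "inj_on \<pi> B"
  shows "standardize \<pi> B permutes {1..card B}"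
proof (rule bij_imp_permutes)
  let ?s = "standardize \<pi> B"
  have i: "inj_on ?s {1..card B}"
  proof (rule inj_onI)
    fix x y assume xy: "x \<in> {1..card B}" "y \<in> {1..card B}" "?s x = ?s y"
    then have "\<pi> (nth_position B x) = \<pi> (nth_position B y)"
      using standardize_less_iff[OF B xy(1,2), of \<pi>] standardize_less_iff[OF B xy(2,1), of \<pi>] by simp
    then have "nth_position B x = nth_position B y"
      using inj nth_position_in[OF B] xy by (meson inj_onD)
    then show "x = y"
      using bij_betw_nth_position[OF B] xy by (meson bij_betw_imp_inj_on inj_onD)
  qed
  have "?s x \<in> {1..card B}" if "x \<in> {1..card B}" for x
  proof -
    have f: "finite {w \<in> \<pi> ` B. w \<le> \<pi> (nth_position B x)}" using B by simp
    have "\<pi> (nth_position B x) \<in> {w \<in> \<pi> ` B. w \<le> \<pi> (nth_position B x)}"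
      using nth_position_in[OF B that] by auto
    then have "0 < card {w \<in> \<pi> ` B. w \<le> \<pi> (nth_position B x)}"
      using f unfolding card_gt_0_iff by blast
    moreover have "card {w \<in> \<pi> ` B. w \<le> \<pi> (nth_position B x)} \<le> card (\<pi> ` B)"
      using B by (intro card_mono) auto
    ultimately show ?thesis using that card_image_le[OF B, of \<pi>] unfolding standardize_def by auto
  qed
  then have "?s ` {1..card B} \<subseteq> {1..card B}" by blast
  then have "?s ` {1..card B} = {1..card B}"
    using i by (intro endo_inj_surj) auto
  then show "bij_betw ?s {1..card B} {1..card B}" using i by (simp add: bij_betw_def)
qed (auto simp: standardize_def)

lemma occurrence_on_standardize:
  assumes B: "finite B" and inj: "inj_on \<pi> B" and J: "J \<subseteq> {1..card B}"
  shows "occurrence_on p B \<pi> (nth_position B ` J) \<longleftrightarrow>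
    occurrence_on p {1..card B} (standardize \<pi> B) J"
proof -
  let ?e = "nth_position B" and ?s = "standardize \<pi> B" and ?X = "{1..card B}"
  have e: "inj_on ?e ?X" "?e ` ?X = B"
    using bij_betw_nth_position[OF B] by (auto simp: bij_betw_def)
  have s: "inj_on ?s ?X"
    using permutes_inj[OF standardize_permutes[OF B inj]] inj_on_subset by blast
  have b1: "below (?e ` J) (?e x) = below J x" if "x \<in> ?X" for x
    by (rule below_image[OF e(1) J that]) (use B that nth_position_less_iff in auto)
  have b2: "below (?s ` J) (?s x) = below (\<pi> ` ?e ` J) (\<pi> (?e x))" if x: "x \<in> ?X" for x
  proof -
    have "{w \<in> \<pi> ` ?e ` J. w < \<pi> (?e x)} = (\<lambda>y. \<pi> (?e y)) ` {y \<in> J. ?s y < ?s x}"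
      using standardize_less_iff[OF B _ x] J by auto
    moreover have "{w \<in> ?s ` J. w < ?s x} = ?s ` {y \<in> J. ?s y < ?s x}" by auto
    moreover have "inj_on (\<lambda>y. \<pi> (?e y)) ?X"
      using comp_inj_on[of ?e ?X \<pi>] e inj by (simp add: comp_def)
    then have "inj_on (\<lambda>y. \<pi> (?e y)) {y \<in> J. ?s y < ?s x}"
      by (rule inj_on_subset) (use J in auto)
    moreover have "inj_on ?s {y \<in> J. ?s y < ?s x}"
      by (rule inj_on_subset[OF s]) (use J in auto)
    ultimately show ?thesis unfolding below_def by (simp add: card_image)
  qed
  have c: "card (?e ` J) = card J" using e J by (simp add: card_image inj_on_subset)
  have sub: "?e ` J \<subseteq> B" using e J by blast
  have diff: "B - ?e ` J = ?e ` (?X - J)" using e J inj_on_image_set_diff[OF e(1), of ?X J] by simp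
  have "(\<forall>x\<in>J. mp_perm p (Suc (below (?e ` J) (?e x))) = Suc (below (\<pi> ` ?e ` J) (\<pi> (?e x)))) \<longleftrightarrow>
      (\<forall>x\<in>J. mp_perm p (Suc (below J x)) = Suc (below (?s ` J) (?s x)))"
  proof (rule ball_cong[OF refl])
    fix x assume "x \<in> J"
    then have "x \<in> ?X" using J by blast
    then show "(mp_perm p (Suc (below (?e ` J) (?e x))) = Suc (below (\<pi> ` ?e ` J) (\<pi> (?e x)))) =
      (mp_perm p (Suc (below J x)) = Suc (below (?s ` J) (?s x)))" by (simp only: b1 b2)
  qed
  moreover have "(\<forall>x\<in>?X - J. (below (?e ` J) (?e x), below (\<pi> ` ?e ` J) (\<pi> (?e x))) \<notin> mp_shaded p) \<longleftrightarrow>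
      (\<forall>x\<in>?X - J. (below J x, below (?s ` J) (?s x)) \<notin> mp_shaded p)"
  proof (rule ball_cong[OF refl])
    fix x assume "x \<in> ?X - J"
    then have "x \<in> ?X" by blast
    then show "((below (?e ` J) (?e x), below (\<pi> ` ?e ` J) (\<pi> (?e x))) \<notin> mp_shaded p) =
      ((below J x, below (?s ` J) (?s x)) \<notin> mp_shaded p)" by (simp only: b1 b2)
  qed
  ultimately show ?thesis
    unfolding occurrence_on_def diff using c sub J by simp
qed


lemma below_outside:
  assumes fin: "finite I" "finite J" and J: "\<forall>y\<in>J. y \<notin> I \<and> below I y = a"
  shows "below I x < a \<Longrightarrow> below J x = 0"
    and "below I x > a \<Longrightarrow> below J x = card J"
    and "x \<in> I \<Longrightarrow> below I x = a \<Longrightarrow> below J x = card J"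
proof -
  show "below J x = 0" if "below I x < a"
  proof -
    have "{y \<in> J. y < x} = {}" using J below_mono[OF fin(1)] that
      by (metis (no_types, lifting) Collect_empty_eq less_imp_le not_le)
    then show ?thesis unfolding below_def by (simp only: card.empty)
  qed
  show "below J x = card J" if "below I x > a"
  proof -
    have "{y \<in> J. y < x} = J" using J below_mono[OF fin(1), of x] that
      by (metis (no_types, lifting) Collect_cong Collect_mem_eq not_le)
    then show ?thesis unfolding below_def by simp
  qed
  show "below J x = card J" if "x \<in> I" "below I x = a"
  proof -
    have "y < x" if "y \<in> J" for y
      using bspec[OF J that] below_strict[OF fin(1), of x y] \<open>x \<in> I\<close> \<open>below I x = a\<close>
      by (metis less_irrefl linorder_neqE_nat)
    then have "{y \<in> J. y < x} = J" by blast
    then show ?thesis unfolding below_def by simp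
  qed
qed

lemma below_Un_box:
  assumes fin: "finite I" "finite J" and J: "\<forall>y\<in>J. y \<notin> I \<and> below I y = a"
  shows "x \<in> I \<Longrightarrow> below (I \<union> J) x = (if below I x < a then below I x else below I x + card J)"
    and "x \<in> J \<Longrightarrow> below (I \<union> J) x = a + below J x"
    and "x \<notin> I \<Longrightarrow> coarsen a (card J) (below (I \<union> J) x) = below I x"
    and "x \<notin> I \<Longrightarrow> below (I \<union> J) x \<in> {a..a + card J} \<longleftrightarrow> below I x = a"
    and "below I x = a \<Longrightarrow> below (I \<union> J) x - a = below J x"
proof -
  have un: "below (I \<union> J) x = below I x + below J x" for x
    using J fin by (intro below_Un_disjoint) auto
  note o = below_outside[OF fin J]
  have le: "below J x \<le> card J" by (rule below_le_card[OF fin(2)])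
  consider "below I x < a" "below J x = 0" | "below I x = a" | "below I x > a" "below J x = card J"
    using o(1,2)[of x] by linarith
  note c = this
  show "x \<in> I \<Longrightarrow> below (I \<union> J) x = (if below I x < a then below I x else below I x + card J)"
    using c o(3)[of x] un[of x] by (cases rule: c) auto
  show "x \<in> J \<Longrightarrow> below (I \<union> J) x = a + below J x" using J un by simp
  show "coarsen a (card J) (below (I \<union> J) x) = below I x" if "x \<notin> I"
    by (cases rule: c) (use le un[of x] in \<open>auto simp: coarsen_def\<close>)
  show "below (I \<union> J) x \<in> {a..a + card J} \<longleftrightarrow> below I x = a" if "x \<notin> I"
    by (cases rule: c) (use le un[of x] in auto)
  show "below I x = a \<Longrightarrow> below (I \<union> J) x - a = below J x" using un by simp
qed

lemma insert_perm_iff_base: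
  assumes "r \<in> {1..k}" and "a \<le> k"
  shows "insert_perm k \<tau> (a, b) m \<sigma> (if r \<le> a then r else r + m) =
      (if v \<le> b then v else v + m) \<longleftrightarrow> \<tau> r = v"
  using assms by (auto simp: insert_perm_def Let_def)

lemma insert_perm_inserted:
  "r \<in> {1..m} \<Longrightarrow> insert_perm k \<tau> (a, b) m \<sigma> (a + r) = b + \<sigma> r"
  by (auto simp: insert_perm_def Let_def)

lemma occurrence_on_mesh_insert_iff:
  assumes I: "finite I" "I \<subseteq> B" "card I = mp_length p"
    and fB: "finite B" and inj: "inj_on \<pi> B"
    and X: "X = {x \<in> B - I. below I x = a \<and> below (\<pi> ` I) (\<pi> x) = b}"
    and J: "J \<subseteq> X" "card J = mp_length q"
    and c: "a \<le> mp_length p" "b \<le> mp_length p" "(a, b) \<notin> mp_shaded p"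
  shows "occurrence_on (mesh_insert p (a, b) q) B \<pi> (I \<union> J) \<longleftrightarrow>
    occurrence_on p B \<pi> I \<and> occurrence_on q X \<pi> J"
proof -
  let ?k = "mp_length p" and ?m = "mp_length q" and ?K = "I \<union> J"
  let ?T = "insert_perm ?k (mp_perm p) (a, b) ?m (mp_perm q)"
  have J': "J \<subseteq> B" "J \<inter> I = {}" using J X by auto
  have fJ: "finite J" using J' fB finite_subset by blast
  have cK: "card ?K = ?k + ?m" using I J J' fJ by (subst card_Un_disjoint) auto
  have injK: "inj_on \<pi> J" "inj_on \<pi> I" using inj J' I inj_on_subset by blast+
  have cJ: "card (\<pi> ` J) = ?m" "card (\<pi> ` I) = ?k" using injK J I by (simp_all add: card_image)
  have pos: "\<forall>y\<in>J. y \<notin> I \<and> below I y = a" using J X by auto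
  have val: "\<forall>y\<in>\<pi> ` J. y \<notin> \<pi> ` I \<and> below (\<pi> ` I) y = b"
  proof
    fix y assume "y \<in> \<pi> ` J"
    then obtain x where x: "x \<in> J" "y = \<pi> x" by blast
    then have "x \<in> X" using J by blast
    then show "y \<notin> \<pi> ` I \<and> below (\<pi> ` I) y = b"
      using x X inj_on_image_mem_iff[OF inj _ I(2), of x] by simp
  qed
  note P = below_Un_box[OF I(1) fJ pos, unfolded J(2)]
  note V = below_Un_box[OF finite_imageI[OF I(1)] finite_imageI[OF fJ] val, unfolded cJ,
      folded image_Un]
  have out: "\<pi> x \<notin> \<pi> ` I" if "x \<in> B - I" for x
    using that inj_on_image_mem_iff[OF inj _ I(2), of x] by simp
  have p1: "?T (Suc (below ?K x)) = Suc (below (\<pi> ` ?K) (\<pi> x)) \<longleftrightarrow>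
      mp_perm p (Suc (below I x)) = Suc (below (\<pi> ` I) (\<pi> x))" if x: "x \<in> I" for x
  proof -
    have "Suc (below I x) \<in> {1..?k}" using below_less_card[OF I(1) x] I by auto
    moreover have "Suc (below ?K x) =
        (if Suc (below I x) \<le> a then Suc (below I x) else Suc (below I x) + ?m)"
      using P(1)[OF x] by auto
    moreover have "Suc (below (\<pi> ` ?K) (\<pi> x)) =
        (if Suc (below (\<pi> ` I) (\<pi> x)) \<le> b then Suc (below (\<pi> ` I) (\<pi> x))
         else Suc (below (\<pi> ` I) (\<pi> x)) + ?m)"
      using V(1)[of "\<pi> x"] x by auto
    ultimately show ?thesis using insert_perm_iff_base c by presburger
  qed
  have p2: "?T (Suc (below ?K x)) = Suc (below (\<pi> ` ?K) (\<pi> x)) \<longleftrightarrow>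
      mp_perm q (Suc (below J x)) = Suc (below (\<pi> ` J) (\<pi> x))" if x: "x \<in> J" for x
  proof -
    have "Suc (below J x) \<in> {1..?m}" using below_less_card[OF fJ x] J by auto
    then have "?T (a + Suc (below J x)) = b + mp_perm q (Suc (below J x))"
      by (rule insert_perm_inserted)
    then show ?thesis using P(2)[OF x] V(2)[of "\<pi> x"] x by simp
  qed
  have s: "(below ?K x, below (\<pi> ` ?K) (\<pi> x)) \<notin> mp_shaded (mesh_insert p (a, b) q) \<longleftrightarrow>
      (below I x, below (\<pi> ` I) (\<pi> x)) \<notin> mp_shaded p \<and>
      (x \<in> X \<longrightarrow> (below J x, below (\<pi> ` J) (\<pi> x)) \<notin> mp_shaded q)" if x: "x \<in> B - ?K" for x
  proof -
    have "below ?K x \<le> ?k + ?m" using below_le_card[of ?K x] cK I fJ by simp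
    moreover have "below (\<pi> ` ?K) (\<pi> x) \<le> ?k + ?m"
      using below_le_card[of "\<pi> ` ?K" "\<pi> x"] card_image_le[of ?K \<pi>] cK I fJ by simp
    moreover have xI: "x \<in> B - I" "x \<notin> I" "\<pi> x \<notin> \<pi> ` I" using x out by auto
    ultimately show ?thesis
      unfolding mesh_insert_def Let_def prod.case mesh_pattern.sel mem_Collect_eq
        P(3)[OF xI(2)] V(3)[OF xI(3)] P(4)[OF xI(2)] V(4)[OF xI(3)]
      using P(5)[of x] V(5)[of "\<pi> x"] xI X by auto
  qed
  have t: "mp_length (mesh_insert p (a, b) q) = ?k + ?m" "mp_perm (mesh_insert p (a, b) q) = ?T"
    by (simp_all add: mesh_insert_def Let_def)
  have x1: "(\<forall>x\<in>?K. ?T (Suc (below ?K x)) = Suc (below (\<pi> ` ?K) (\<pi> x))) \<longleftrightarrow>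
      (\<forall>x\<in>I. mp_perm p (Suc (below I x)) = Suc (below (\<pi> ` I) (\<pi> x))) \<and>
      (\<forall>x\<in>J. mp_perm q (Suc (below J x)) = Suc (below (\<pi> ` J) (\<pi> x)))"
    unfolding ball_Un
    by (rule arg_cong2[where f = "(\<and>)"]; rule ball_cong[OF refl]; (erule p1 | erule p2))
  have sJ: "(below I x, below (\<pi> ` I) (\<pi> x)) \<notin> mp_shaded p" if "x \<in> J" for x
    using that J X c by auto
  have "(\<forall>x\<in>B - ?K. (below ?K x, below (\<pi> ` ?K) (\<pi> x)) \<notin> mp_shaded (mesh_insert p (a, b) q)) \<longleftrightarrow>
      (\<forall>x\<in>B - ?K. (below I x, below (\<pi> ` I) (\<pi> x)) \<notin> mp_shaded p \<and>
      (x \<in> X \<longrightarrow> (below J x, below (\<pi> ` J) (\<pi> x)) \<notin> mp_shaded q))"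
    by (rule ball_cong[OF refl]) (rule s)
  also have "\<dots> \<longleftrightarrow> (\<forall>x\<in>B - I. (below I x, below (\<pi> ` I) (\<pi> x)) \<notin> mp_shaded p) \<and>
      (\<forall>x\<in>X - J. (below J x, below (\<pi> ` J) (\<pi> x)) \<notin> mp_shaded q)"
    using sJ X by blast
  finally have x2: "(\<forall>x\<in>B - ?K. (below ?K x, below (\<pi> ` ?K) (\<pi> x)) \<notin> mp_shaded (mesh_insert p (a, b) q)) \<longleftrightarrow>
      (\<forall>x\<in>B - I. (below I x, below (\<pi> ` I) (\<pi> x)) \<notin> mp_shaded p) \<and>
      (\<forall>x\<in>X - J. (below J x, below (\<pi> ` J) (\<pi> x)) \<notin> mp_shaded q)" .
  show ?thesis
    unfolding occurrence_on_def t x1 x2 using cK I J J' by blast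
qed

lemma below_middle:
  assumes K: "finite K" "a + m \<le> card K"
    and J: "J = {x \<in> K. a \<le> below K x \<and> below K x < a + m}"
  shows "card J = m" and "card (K - J) = card K - m" and "x \<in> J \<Longrightarrow> below (K - J) x = a"
proof -
  have b: "inj_on (below K) K" "below K ` K = {..<card K}"
    using bij_betw_below[OF K(1)] by (auto simp: bij_betw_def)
  have cnt: "card {x \<in> K. P (below K x)} = card {r \<in> {..<card K}. P r}" for P
  proof -
    have "{r \<in> {..<card K}. P r} = below K ` {x \<in> K. P (below K x)}" unfolding b(2)[symmetric] by auto
    moreover have "inj_on (below K) {x \<in> K. P (below K x)}" by (rule inj_on_subset[OF b(1)]) auto
    ultimately show ?thesis by (simp add: card_image)
  qed
  have "card J = card {r \<in> {..<card K}. a \<le> r \<and> r < a + m}" unfolding J by (rule cnt)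
  also have "{r \<in> {..<card K}. a \<le> r \<and> r < a + m} = {a..<a + m}" using K by auto
  finally show cJ: "card J = m" by simp
  show "card (K - J) = card K - m" using cJ J K by (subst card_Diff_subset) auto
  assume x: "x \<in> J"
  have "{y \<in> K - J. y < x} = {y \<in> K. below K y < a}"
  proof (intro equalityI subsetI)
    fix y assume "y \<in> {y \<in> K - J. y < x}"
    then show "y \<in> {y \<in> K. below K y < a}"
      using x below_strict[OF K(1), of y x] unfolding J by auto
  next
    fix y assume "y \<in> {y \<in> K. below K y < a}"
    then show "y \<in> {y \<in> K - J. y < x}"
      using x below_less_iff[OF K(1), of y x] unfolding J by auto
  qed
  then have "below (K - J) x = card {r \<in> {..<card K}. r < a}" using cnt[of "\<lambda>r. r < a"]
    unfolding below_def[of "K - J"] by simp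
  also have "{r \<in> {..<card K}. r < a} = {..<a}" using K by auto
  finally show "below (K - J) x = a" by simp
qed

lemma middle_unique:
  assumes fin: "finite I" "finite J" and J: "\<forall>y\<in>J. y \<notin> I \<and> below I y = a"
  shows "J = {x \<in> I \<union> J. a \<le> below (I \<union> J) x \<and> below (I \<union> J) x < a + card J}"
  using below_Un_box(1,2)[OF fin J] below_less_card[OF fin(2)]
  by (auto split: if_splits)

lemma is_mesh_pattern_mesh_insert:
  assumes p: "is_mesh_pattern p" and q: "is_mesh_pattern q" and c: "a \<le> mp_length p" "b \<le> mp_length p"
  shows "is_mesh_pattern (mesh_insert p (a, b) q)"
proof -
  let ?k = "mp_length p" and ?m = "mp_length q"
  let ?\<tau> = "mp_perm p" and ?\<sigma> = "mp_perm q"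
  let ?T = "insert_perm ?k ?\<tau> (a, b) ?m ?\<sigma>"
  define L where "L = (\<lambda>v. if v \<le> b then v else v + ?m)"
  have \<tau>: "?\<tau> permutes {1..?k}" and \<sigma>: "?\<sigma> permutes {1..?m}"
    using p q by (auto simp: is_mesh_pattern_def)
  have t: "?\<tau> x \<in> {1..?k}" if "x \<in> {1..?k}" for x using \<tau> that by (simp only: permutes_in_image)
  have u: "?\<sigma> x \<in> {1..?m}" if "x \<in> {1..?m}" for x using \<sigma> that by (simp only: permutes_in_image)
  have split: "(\<exists>z\<in>{1..?k}. x = (if z \<le> a then z else z + ?m) \<and> ?T x = L (?\<tau> z)) \<or>
      (\<exists>z\<in>{1..?m}. x = a + z \<and> ?T x = b + ?\<sigma> z)" if x: "x \<in> {1..?k + ?m}" for x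
  proof -
    consider "x \<le> a" | "a < x" "x \<le> a + ?m" | "a + ?m < x" by linarith
    then show ?thesis
    proof cases
      case 1
      then show ?thesis using x c by (intro disjI1 bexI[of _ x]) (auto simp: insert_perm_def Let_def L_def)
    next
      case 2
      then show ?thesis using x c
        by (intro disjI2 bexI[of _ "x - a"]) (auto simp: insert_perm_def Let_def L_def)
    next
      case 3
      then show ?thesis using x c
        by (intro disjI1 bexI[of _ "x - ?m"]) (auto simp: insert_perm_def Let_def L_def)
    qed
  qed
  have L: "v = w" if "L v = L w" for v w using that by (auto simp: L_def split: if_splits)
  have NL: "L v \<noteq> b + ?\<sigma> z" if "z \<in> {1..?m}" for v z using u[OF that] by (auto simp: L_def)
  have inj: "inj_on ?T {1..?k + ?m}"
  proof (rule inj_onI)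
    fix x y assume "x \<in> {1..?k + ?m}" "y \<in> {1..?k + ?m}" and e: "?T x = ?T y"
    note sx = split[OF this(1)] and sy = split[OF this(2)]
    show "x = y" using sx
    proof (elim disjE bexE conjE)
      fix z assume z: "z \<in> {1..?k}" "x = (if z \<le> a then z else z + ?m)" "?T x = L (?\<tau> z)"
      show ?thesis using sy
      proof (elim disjE bexE conjE)
        fix w assume w: "w \<in> {1..?k}" "y = (if w \<le> a then w else w + ?m)" "?T y = L (?\<tau> w)"
        have "?\<tau> z = ?\<tau> w" by (rule L) (use z(3) w(3) e in simp)
        then show ?thesis using permutes_inj[OF \<tau>] z(2) w(2) by (metis injD)
      next
        fix w assume w: "w \<in> {1..?m}" "y = a + w" "?T y = b + ?\<sigma> w"
        then show ?thesis using NL[OF w(1), of "?\<tau> z"] z(3) e by simp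
      qed
    next
      fix z assume z: "z \<in> {1..?m}" "x = a + z" "?T x = b + ?\<sigma> z"
      show ?thesis using sy
      proof (elim disjE bexE conjE)
        fix w assume w: "w \<in> {1..?k}" "y = (if w \<le> a then w else w + ?m)" "?T y = L (?\<tau> w)"
        then show ?thesis using NL[OF z(1), of "?\<tau> w"] z(3) e by simp
      next
        fix w assume w: "w \<in> {1..?m}" "y = a + w" "?T y = b + ?\<sigma> w"
        have "?\<sigma> z = ?\<sigma> w" using z(3) w(3) e w(2) z(2) by simp
        then show ?thesis using permutes_inj[OF \<sigma>] z(2) w(2) by (metis injD)
      qed
    qed
  qed
  have "?T x \<in> {1..?k + ?m}" if "x \<in> {1..?k + ?m}" for x
    using split[OF that]
  proof (elim disjE bexE conjE)
    fix z assume "z \<in> {1..?k}" "?T x = L (?\<tau> z)"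
    then show ?thesis using t[of z] by (auto simp: L_def)
  next
    fix z assume "z \<in> {1..?m}" "?T x = b + ?\<sigma> z"
    then show ?thesis using u[of z] c by auto
  qed
  then have "?T ` {1..?k + ?m} \<subseteq> {1..?k + ?m}" by blast
  then have "?T ` {1..?k + ?m} = {1..?k + ?m}" using inj by (intro endo_inj_surj) auto
  moreover have "?T x = x" if "x \<notin> {1..?k + ?m}" for x
  proof -
    have "x = 0 \<or> x > ?k + ?m" using that by auto
    moreover have "?\<tau> 0 = 0" using \<tau> by (simp add: permutes_def)
    ultimately show ?thesis using c by (auto simp: insert_perm_def Let_def)
  qed
  ultimately have "?T permutes {1..?k + ?m}"
    using inj by (intro bij_imp_permutes) (auto simp: bij_betw_def)
  then show ?thesis unfolding is_mesh_pattern_def mesh_insert_def by (auto simp: Let_def)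
qed

theorem bij_betw_occurrences_mesh_insert:
  assumes \<pi>: "\<pi> permutes {1..n}" and p: "is_mesh_pattern p" and q: "is_mesh_pattern q"
    and c: "a \<le> mp_length p" "b \<le> mp_length p" "(a, b) \<notin> mp_shaded p"
  shows "bij_betw (\<lambda>(I, J). I \<union> nth_position (mesh_box n \<pi> I (a, b)) ` J)
     (SIGMA I:occurrences p n \<pi>. let B = mesh_box n \<pi> I (a, b)
        in occurrences q (card B) (standardize \<pi> B))
     (occurrences (mesh_insert p (a, b) q) n \<pi>)"
proof -
  let ?B = "{1..n}" and ?r = "mesh_insert p (a, b) q"
  let ?k = "mp_length p" and ?m = "mp_length q"
  let ?X = "\<lambda>I. mesh_box n \<pi> I (a, b)"
  let ?e = "\<lambda>I. nth_position (?X I)"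
  have inj: "inj_on \<pi> A" for A using permutes_inj[OF \<pi>] inj_on_subset by blast
  have r: "is_mesh_pattern ?r" by (rule is_mesh_pattern_mesh_insert[OF p q c(1,2)])
  have X: "?X I = {j \<in> ?B - I. below I j = a \<and> below (\<pi> ` I) (\<pi> j) = b}"
    if "I \<subseteq> ?B" "card I = ?k" for I
    using mesh_box_eq[OF \<pi> that(1), of a b] c that by simp
  have fX: "finite (?X I)" for I unfolding mesh_box_def by auto
  have subq: "J \<subseteq> A" if "occurrence_on q A \<sigma> J" for A \<sigma> J
    using that unfolding occurrence_on_def by blast
  have q_iff: "J \<in> occurrences q (card (?X I)) (standardize \<pi> (?X I)) \<longleftrightarrow>
      J \<subseteq> {1..card (?X I)} \<and> occurrence_on q (?X I) \<pi> (?e I ` J)" for I J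
    using occurrences_iff[OF standardize_permutes[OF fX inj] q, of J I]
      occurrence_on_standardize[OF fX inj, of J I q] subq[of "{1..card (?X I)}" _ J] by blast
  have key: "occurrence_on ?r ?B \<pi> (I \<union> J) \<longleftrightarrow> occurrence_on p ?B \<pi> I \<and> occurrence_on q (?X I) \<pi> J"
    if "I \<subseteq> ?B" "card I = ?k" "J \<subseteq> ?X I" "card J = ?m" for I J
    by (rule occurrence_on_mesh_insert_iff[OF _ that(1,2) _ inj X[OF that(1,2)] that(3,4) c])
       (use that finite_subset in auto)
  let ?S = "SIGMA I:occurrences p n \<pi>. occurrences q (card (?X I)) (standardize \<pi> (?X I))"
  let ?f = "\<lambda>(I, J). I \<union> ?e I ` J"
  have S: "I \<subseteq> ?B \<and> card I = ?k \<and> J \<subseteq> {1..card (?X I)} \<and> ?e I ` J \<subseteq> ?X I \<and> card (?e I ` J) = ?m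
     \<and> occurrence_on p ?B \<pi> I \<and> occurrence_on q (?X I) \<pi> (?e I ` J)" if "(I, J) \<in> ?S" for I J
    using that q_iff occurrences_iff[OF \<pi> p] unfolding occurrence_on_def by auto
  have mid: "?e I ` J = {x \<in> I \<union> ?e I ` J. a \<le> below (I \<union> ?e I ` J) x \<and> below (I \<union> ?e I ` J) x < a + ?m}"
    if "(I, J) \<in> ?S" for I J
  proof -
    note s = S[OF that]
    have "finite I" using s finite_subset[of I ?B] by auto
    moreover have "finite (?e I ` J)" using s fX finite_subset by blast
    moreover have "\<forall>y\<in>?e I ` J. y \<notin> I \<and> below I y = a"
    proof
      fix y assume "y \<in> ?e I ` J"
      then have "y \<in> ?X I" using s by blast
      then show "y \<notin> I \<and> below I y = a" using X s by auto
    qed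
    ultimately have "?e I ` J = {x \<in> I \<union> ?e I ` J. a \<le> below (I \<union> ?e I ` J) x \<and>
        below (I \<union> ?e I ` J) x < a + card (?e I ` J)}"
      by (rule middle_unique)
    then show ?thesis using s by simp
  qed
  have "inj_on ?f ?S"
  proof (rule inj_onI, clarify)
    fix I J I' J' assume s: "I \<in> occurrences p n \<pi>" "J \<in> occurrences q (card (?X I)) (standardize \<pi> (?X I))"
      "I' \<in> occurrences p n \<pi>" "J' \<in> occurrences q (card (?X I')) (standardize \<pi> (?X I'))"
      and eq: "I \<union> ?e I ` J = I' \<union> ?e I' ` J'"
    have s1: "(I, J) \<in> ?S" and s2: "(I', J') \<in> ?S" using s by auto
    have eJ: "?e I ` J = ?e I' ` J'" using mid[OF s1] mid[OF s2] eq by simp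
    have d: "?e A ` C \<inter> A = {}" if "(A, C) \<in> ?S" for A C
    proof -
      have "?X A \<inter> A = {}" using X[of A] S[OF that] by auto
      then show ?thesis using S[OF that] by blast
    qed
    have "I = (I \<union> ?e I ` J) - ?e I ` J" using d[OF s1] by blast
    also have "\<dots> = (I' \<union> ?e I' ` J') - ?e I' ` J'" by (rule arg_cong2[where f = "(-)", OF eq eJ])
    also have "\<dots> = I'" using d[OF s2] by blast
    finally have "I = I'" .
    moreover have "J = J'" if "I = I'"
    proof -
      have "inj_on (?e I) {1..card (?X I)}"
        using bij_betw_nth_position[OF fX] by (simp add: bij_betw_def)
      then show ?thesis using eJ S[OF s1] S[OF s2] that by (simp add: inj_on_image_eq_iff)
    qed
    ultimately show "I = I' \<and> J = J'" by simp
  qed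
  moreover have "?f ` ?S = occurrences ?r n \<pi>"
  proof (intro equalityI subsetI)
    fix K assume "K \<in> ?f ` ?S"
    then obtain I J where IJ: "(I, J) \<in> ?S" "K = I \<union> ?e I ` J" by auto
    then show "K \<in> occurrences ?r n \<pi>"
      using S[OF IJ(1)] key[of I "?e I ` J"] occurrences_iff[OF \<pi> r] by blast
  next
    fix K assume "K \<in> occurrences ?r n \<pi>"
    then have occ: "occurrence_on ?r ?B \<pi> K" using occurrences_iff[OF \<pi> r] by blast
    let ?T = "insert_perm ?k (mp_perm p) (a, b) ?m (mp_perm q)"
    have K: "K \<subseteq> ?B" "card K = ?k + ?m" "finite K"
      and T: "\<And>x. x \<in> K \<Longrightarrow> ?T (Suc (below K x)) = Suc (below (\<pi> ` K) (\<pi> x))"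
      using occ finite_subset[of K ?B] unfolding occurrence_on_def mesh_insert_def
      by (auto simp: Let_def)
    have cK: "card (\<pi> ` K) = ?k + ?m" using K inj by (simp add: card_image)
    define J where "J = {x \<in> K. a \<le> below K x \<and> below K x < a + ?m}"
    define I where "I = K - J"
    have KIJ: "K = I \<union> J" by (auto simp: I_def J_def)
    have \<sigma>: "mp_perm q permutes {1..?m}" using q by (simp add: is_mesh_pattern_def)
    have iff: "a \<le> below K x \<and> below K x < a + ?m \<longleftrightarrow>
        b \<le> below (\<pi> ` K) (\<pi> x) \<and> below (\<pi> ` K) (\<pi> x) < b + ?m" if x: "x \<in> K" for x
    proof (cases "a \<le> below K x \<and> below K x < a + ?m")
      case True
      then have "Suc (below K x) - a \<in> {1..?m}" by auto
      then have "mp_perm q (Suc (below K x) - a) \<in> {1..?m}" using \<sigma> by (simp only: permutes_in_image)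
      moreover have "Suc (below (\<pi> ` K) (\<pi> x)) = b + mp_perm q (Suc (below K x) - a)"
        using T[OF x] True by (auto simp: insert_perm_def Let_def)
      ultimately show ?thesis using True by auto
    next
      case False
      have "below K x < ?k + ?m" using below_less_card[OF K(3) x] K by simp
      then show ?thesis
        using False T[OF x] by (auto simp: insert_perm_def Let_def split: if_splits)
    qed
    have \<pi>J: "\<pi> ` J = {v \<in> \<pi> ` K. b \<le> below (\<pi> ` K) v \<and> below (\<pi> ` K) v < b + ?m}"
      unfolding J_def using iff by auto
    have \<pi>I: "\<pi> ` K - \<pi> ` J = \<pi> ` I"
      unfolding I_def using image_set_diff[OF permutes_inj[OF \<pi>]] by simp
    have M: "card J = ?m" "card I = ?k" "\<And>x. x \<in> J \<Longrightarrow> below I x = a"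
      using below_middle[OF K(3) _ J_def] K c unfolding I_def by auto
    have N: "\<And>x. x \<in> J \<Longrightarrow> below (\<pi> ` I) (\<pi> x) = b"
      using below_middle(3)[OF finite_imageI[OF K(3)] _ \<pi>J] cK c unfolding \<pi>I by auto
    have IB: "I \<subseteq> ?B" using K I_def by blast
    have JX: "J \<subseteq> ?X I" unfolding X[OF IB M(2)] using K M N by (auto simp: I_def J_def)
    have o: "occurrence_on p ?B \<pi> I" "occurrence_on q (?X I) \<pi> J"
      using key[OF IB M(2) JX M(1)] occ KIJ by auto
    define J' where "J' = {x \<in> {1..card (?X I)}. ?e I x \<in> J}"
    have "?e I ` {1..card (?X I)} = ?X I"
      using bij_betw_nth_position[OF fX] by (simp add: bij_betw_def)
    then have "J \<subseteq> ?e I ` {1..card (?X I)}" using JX by simp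
    have J': "?e I ` J' = J"
    proof (intro equalityI subsetI)
      fix y assume "y \<in> J"
      then have "y \<in> ?e I ` {1..card (?X I)}"
        by (rule subsetD[OF \<open>J \<subseteq> ?e I ` {1..card (?X I)}\<close>])
      then obtain x where "x \<in> {1..card (?X I)}" "y = ?e I x" by (rule imageE)
      then show "y \<in> ?e I ` J'" using \<open>y \<in> J\<close> by (simp add: J'_def)
    qed (auto simp: J'_def)
    have J'': "J' \<subseteq> {1..card (?X I)}" unfolding J'_def by blast
    then have "(I, J') \<in> ?S" using J' J'' q_iff[of J' I] o occurrences_iff[OF \<pi> p, of I] by simp
    moreover have "K = ?f (I, J')" using J' KIJ by simp
    ultimately show "K \<in> ?f ` ?S" by (rule rev_image_eqI)
  qed
  ultimately show ?thesis by (simp add: bij_betw_def Let_def)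
qed

end

theory Submission
  imports Defs
begin

text \<open>
  Let the base pattern \<open>12\<close> occur in \<open>\<pi> \<in> S\<^sub>n\<close> at positions \<open>i < j\<close>.  The shading says that every
  other element before position \<open>j\<close> is below \<open>\<pi> i\<close>, and that every element after position \<open>j\<close>
  has a value strictly between \<open>\<pi> i\<close> and \<open>\<pi> j\<close>.  Hence \<open>\<pi> j = n\<close>, the first \<open>a = j - 1\<close>
  entries of \<open>\<pi>\<close> form a nonempty permutation of \<open>{1..a}\<close> whose maximum is at \<open>i\<close>, and the
  entries after the maximum \<open>n\<close> are exactly those in the box \<open>(2, 1)\<close>
  (\<open>twelve_mesh_occurrence_iff_max_splits\<close>).  Conversely, each decomposition
  \<open>\<pi> = \<alpha> n (\<beta> + a)\<close> with \<open>\<alpha> \<in> S\<^sub>a\<close>, \<open>a \<ge> 1\<close> and \<open>\<beta> \<in> S\<^bsub>n-1-a\<^esub>\<close> gives such an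
  occurrence.  The position of \<open>n\<close> determines \<open>a\<close>, so \<open>\<pi>\<close> has at most one occurrence of the base
  pattern, and \<open>p(\<pi>)\<close> is \<open>p\<^sub>1(\<beta>)\<close> if \<open>\<pi>\<close> decomposes and \<open>0\<close> otherwise.

  Therefore the coefficient of \<open>x\<^sup>n\<close> in \<open>F\<^sub>p - F\<close>, which is the sum of \<open>q\<^bsup>p(\<pi>)\<^esup> - 1\<close> over
  \<open>S\<^sub>n\<close>, only receives contributions from the permutations that decompose.  By the bijection
  \<open>bij_betw_glue\<close> it equals the sum over \<open>a \<ge> 1\<close> of \<open>a!\<close> times the sum of
  \<open>q\<^bsup>p\<^sub>1(\<beta>)\<^esup> - 1\<close> over \<open>S\<^bsub>n-1-a\<^esub>\<close>, which is the coefficient of \<open>x\<^sup>n\<close> in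
  \<open>x (F - 1) (F\<^bsub>p\<^sub>1\<^esub> - F)\<close>.  The formula for \<open>A\<^sub>p\<close> is the case \<open>q = 0\<close>.
\<close>

section \<open>Permutations whose maximum separates the small values from the large ones\<close>

text \<open>
  The permutations of the form \<open>\<alpha> n (\<beta> + a)\<close> with \<open>\<alpha> \<in> S\<^sub>a\<close>.  Requiring \<open>a < n\<close> makes
  \<open>Suc a\<close> a position of \<open>\<pi>\<close>; the case \<open>a = 0\<close>, where \<open>\<pi>\<close> starts with its maximum, is
  included.
\<close>

definition max_splits :: "nat \<Rightarrow> nat \<Rightarrow> (nat \<Rightarrow> nat) set" where
  "max_splits a n = {\<pi>. \<pi> permutes {1..n} \<and> a < n \<and> \<pi> (Suc a) = n \<and> \<pi> ` {1..a} = {1..a}}"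

lemma max_splitsD:
  assumes "\<pi> \<in> max_splits a n"
  shows "\<pi> permutes {1..n}" "a < n" "\<pi> (Suc a) = n" "\<pi> ` {1..a} = {1..a}"
  using assms by (auto simp: max_splits_def)

lemma max_splits_unique:
  assumes "\<pi> \<in> max_splits a n" "\<pi> \<in> max_splits b n"
  shows "a = b"
  using assms permutes_inj[of \<pi> "{1..n}"] unfolding max_splits_def by (auto dest: injD)

lemma max_splits_image_upper:
  assumes "\<pi> \<in> max_splits a n"
  shows "\<pi> ` {Suc (Suc a)..n} = {Suc a..<n}"
proof -
  note s = max_splitsD[OF assms]
  have "{Suc (Suc a)..n} = {1..n} - ({1..a} \<union> {Suc a})" using s(2) by auto
  then have "\<pi> ` {Suc (Suc a)..n} = \<pi> ` {1..n} - (\<pi> ` {1..a} \<union> {\<pi> (Suc a)})"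
    by (simp add: image_set_diff[OF permutes_inj[OF s(1)]])
  also have "\<dots> = {1..n} - ({1..a} \<union> {n})"
    using s(3,4) permutes_image[OF s(1)] by simp
  also have "\<dots> = {Suc a..<n}" using s(2) by auto
  finally show ?thesis .
qed

section \<open>Occurrences of the base pattern\<close>

definition twelve_mesh :: mesh_pattern where
  "twelve_mesh = Mesh 2 id {(0,1), (0,2), (1,1), (1,2), (2,0), (2,2)}"

lemma gridline_pair:
  assumes "i < j"
  shows "gridline n {i, j} 0 = 0" "gridline n {i, j} (Suc 0) = i"
    "gridline n {i, j} 2 = j" "gridline n {i, j} 3 = Suc n"
proof -
  have "sorted_list_of_set {i, j} = [i, j]"
    using assms by (intro sorted_list_of_set_unique[THEN iffD1]) auto
  then show "gridline n {i, j} 0 = 0" "gridline n {i, j} (Suc 0) = i"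
    "gridline n {i, j} 2 = j" "gridline n {i, j} 3 = Suc n"
    by (simp_all add: gridline_def numeral_2_eq_2 numeral_3_eq_3)
qed

lemma mesh_box_pair:
  "mesh_box n \<pi> {i, j} (r, s) = {k \<in> {1..n}.
     gridline n {i, j} r < k \<and> k < gridline n {i, j} (Suc r) \<and>
     gridline n {\<pi> i, \<pi> j} s < \<pi> k \<and> \<pi> k < gridline n {\<pi> i, \<pi> j} (Suc s)}"
  by (simp add: mesh_box_def)

text \<open>
  An element in column 0 or 1 can only lie in row 0, and an element in column 2 can only lie in
  row 1, because the other boxes of these columns are shaded.
\<close>

lemma occurrences_twelve_mesh_pair:
  assumes "\<pi> permutes {1..n}" "i < j"
  shows "{i, j} \<in> occurrences twelve_mesh n \<pi> \<longleftrightarrow>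
    1 \<le> i \<and> j \<le> n \<and> \<pi> i < \<pi> j \<and>
    (\<forall>k\<in>{1..n}. (k < j \<and> k \<noteq> i \<longrightarrow> \<pi> k < \<pi> i) \<and> (j < k \<longrightarrow> \<pi> i < \<pi> k \<and> \<pi> k < \<pi> j))"
proof (cases "1 \<le> i \<and> j \<le> n \<and> \<pi> i < \<pi> j")
  case True
  note g = gridline_pair[OF assms(2), of n] gridline_pair[of "\<pi> i" "\<pi> j" n]
  have inj: "\<pi> x = \<pi> y \<longleftrightarrow> x = y" for x y using permutes_inj[OF assms(1)] by (auto dest: injD)
  have r: "\<pi> k \<in> {1..n}" if "k \<in> {1..n}" for k
    using assms(1) that by (simp only: permutes_in_image)
  have "{i, j} \<in> occurrences twelve_mesh n \<pi> \<longleftrightarrow>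
     (\<forall>c\<in>mp_shaded twelve_mesh. mesh_box n \<pi> {i, j} c = {})"
  proof -
    have "{1..2::nat} = {Suc 0, 2}" by auto
    then show ?thesis
      using True assms(2) g by (auto simp: occurrences_def twelve_mesh_def)
  qed
  also have "\<dots> \<longleftrightarrow> (\<forall>k\<in>{1..n}. (k < j \<and> k \<noteq> i \<longrightarrow> \<pi> k < \<pi> i) \<and>
      (j < k \<longrightarrow> \<pi> i < \<pi> k \<and> \<pi> k < \<pi> j))" (is "_ \<longleftrightarrow> (\<forall>k\<in>_. ?P k)")
  proof -
    have "(\<forall>c\<in>mp_shaded twelve_mesh. k \<notin> mesh_box n \<pi> {i, j} c) \<longleftrightarrow> ?P k" if k: "k \<in> {1..n}" for k
    proof -
      consider "k < i" | "k = i" | "i < k" "k < j" | "k = j" | "j < k" by linarith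
      then show ?thesis
        using True assms(2) g k r[OF k] inj[of k i] inj[of k j]
        by cases (auto simp: twelve_mesh_def mesh_box_pair numeral_2_eq_2[symmetric]
            numeral_3_eq_3[symmetric])
    qed
    moreover have "mesh_box n \<pi> {i, j} c \<subseteq> {1..n}" for c
      by (cases c) (auto simp: mesh_box_def)
    ultimately show ?thesis by blast
  qed
  finally show ?thesis using True by blast
next
  case False
  have "{1..2::nat} = {Suc 0, 2}" by auto
  then have "{i, j} \<notin> occurrences twelve_mesh n \<pi>"
    using False assms(2) gridline_pair[OF assms(2), of n] by (auto simp: occurrences_def twelve_mesh_def)
  then show ?thesis using False by blast
qed

text \<open>
  In an occurrence at \<open>i < Suc a\<close>, every value at a position up to \<open>a\<close> is at most \<open>\<pi> i\<close>, and
  every value at a later position exceeds \<open>\<pi> i\<close>.  So \<open>\<pi>\<close> maps \<open>{1..a}\<close> onto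
  \<open>{1..\<pi> i}\<close>, and comparing cardinalities gives \<open>\<pi> i = a\<close>.  No value exceeds
  \<open>\<pi> (Suc a)\<close>, which is therefore \<open>n\<close>.
\<close>

lemma twelve_mesh_occurrence_iff_max_splits:
  assumes \<pi>: "\<pi> permutes {1..n}" and j: "i < Suc a"
  shows "{i, Suc a} \<in> occurrences twelve_mesh n \<pi> \<longleftrightarrow> 1 \<le> a \<and> \<pi> \<in> max_splits a n \<and> \<pi> i = a"
proof -
  have inj: "\<pi> x = \<pi> y \<longleftrightarrow> x = y" for x y using permutes_inj[OF \<pi>] by (auto dest: injD)
  have r: "\<pi> k \<in> {1..n} \<longleftrightarrow> k \<in> {1..n}" for k
    using \<pi> by (simp only: permutes_in_image)
  show ?thesis
    unfolding occurrences_twelve_mesh_pair[OF assms]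
  proof
    assume L: "1 \<le> i \<and> Suc a \<le> n \<and> \<pi> i < \<pi> (Suc a) \<and> (\<forall>k\<in>{1..n}.
      (k < Suc a \<and> k \<noteq> i \<longrightarrow> \<pi> k < \<pi> i) \<and> (Suc a < k \<longrightarrow> \<pi> i < \<pi> k \<and> \<pi> k < \<pi> (Suc a)))"
    then have L1: "\<pi> k \<le> \<pi> i" if "k \<in> {1..a}" for k
      using that by (cases "k = i") (auto intro: less_imp_le)
    have L2: "\<pi> i < \<pi> k" if "k \<in> {Suc a..n}" for k
      using L that by (cases "k = Suc a") auto
    have L3: "\<pi> k \<le> \<pi> (Suc a)" if "k \<in> {1..n}" for k
    proof (cases "k \<le> a")
      case True
      then show ?thesis using L1[of k] L that by auto
    next
      case False
      then show ?thesis using L that by (cases "k = Suc a") (auto intro: less_imp_le)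
    qed
    have n: "\<pi> (Suc a) = n"
    proof -
      have "n \<in> \<pi> ` {1..n}" using L permutes_image[OF \<pi>] by simp
      then obtain k where "k \<in> {1..n}" "n = \<pi> k" by blast
      then have "n \<le> \<pi> (Suc a)" using L3 by blast
      then show ?thesis using r[of "Suc a"] L by auto
    qed
    have im: "\<pi> ` {1..a} = {1..\<pi> i}"
    proof (intro equalityI subsetI)
      fix v assume "v \<in> \<pi> ` {1..a}"
      then obtain k where "k \<in> {1..a}" "v = \<pi> k" by blast
      then show "v \<in> {1..\<pi> i}" using L1[of k] r[of k] L by auto
    next
      fix v assume v: "v \<in> {1..\<pi> i}"
      moreover have "\<pi> i \<in> {1..n}" using r[of i] L j by auto
      ultimately have "v \<in> \<pi> ` {1..n}" using permutes_image[OF \<pi>] by auto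
      then obtain k where k: "k \<in> {1..n}" "v = \<pi> k" by blast
      then have "k \<in> {1..a}" using L2[of k] v by (cases "k \<le> a") auto
      then show "v \<in> \<pi> ` {1..a}" using k by blast
    qed
    have "card (\<pi> ` {1..a}) = a"
      by (simp add: card_image inj_on_subset[OF permutes_inj[OF \<pi>]])
    then have "\<pi> i = a" using im by simp
    then show "1 \<le> a \<and> \<pi> \<in> max_splits a n \<and> \<pi> i = a"
      using \<pi> L j n im by (auto simp: max_splits_def)
  next
    assume R: "1 \<le> a \<and> \<pi> \<in> max_splits a n \<and> \<pi> i = a"
    then have s: "a < n" "\<pi> (Suc a) = n" "\<pi> ` {1..a} = {1..a}" using max_splitsD by blast+
    have i: "1 \<le> i" using r[of i] R s j by auto
    have "\<pi> k < a" if "k \<in> {1..n}" "k < Suc a" "k \<noteq> i" for k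
    proof -
      have "\<pi> k \<in> \<pi> ` {1..a}" using that by auto
      then show ?thesis using s(3) inj[of k i] that R by auto
    qed
    moreover have "a < \<pi> k \<and> \<pi> k < n" if "k \<in> {1..n}" "Suc a < k" for k
    proof -
      have "\<pi> k \<in> \<pi> ` {Suc (Suc a)..n}" using that by auto
      then show ?thesis using max_splits_image_upper R by auto
    qed
    ultimately show "1 \<le> i \<and> Suc a \<le> n \<and> \<pi> i < \<pi> (Suc a) \<and> (\<forall>k\<in>{1..n}.
      (k < Suc a \<and> k \<noteq> i \<longrightarrow> \<pi> k < \<pi> i) \<and> (Suc a < k \<longrightarrow> \<pi> i < \<pi> k \<and> \<pi> k < \<pi> (Suc a)))"
      using i s R by auto
  qed
qed

lemma occurrence_twelve_mesh_obtains:
  assumes "\<pi> permutes {1..n}" "I \<in> occurrences twelve_mesh n \<pi>"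
  obtains i a where "I = {i, Suc a}" "i < Suc a" "1 \<le> a" "\<pi> \<in> max_splits a n" "\<pi> i = a"
proof -
  have I: "I \<subseteq> {1..n}" "card I = 2"
    using assms(2) by (auto simp: occurrences_def twelve_mesh_def)
  obtain x y where "I = {x, y}" "x \<noteq> y" using I(2) by (auto simp: card_2_iff)
  then obtain i j where ij: "I = {i, j}" "i < j" by (metis insert_commute linorder_neqE_nat)
  then obtain a where a: "j = Suc a" by (cases j) auto
  show ?thesis
    using that[of i a] ij a assms twelve_mesh_occurrence_iff_max_splits[OF assms(1), of i a] by simp
qed

text \<open>
  The next two lemmas show that \<open>\<pi>\<close> contains the base pattern at most once, the lower element
  of the occurrence being the maximum of the part before \<open>n\<close>.  That part must be nonempty,
  hence the condition \<open>1 \<le> a\<close>.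
\<close>

lemma occurrences_twelve_mesh_empty:
  assumes "\<pi> permutes {1..n}" "\<And>a. 1 \<le> a \<Longrightarrow> \<pi> \<notin> max_splits a n"
  shows "occurrences twelve_mesh n \<pi> = {}"
  using assms by (blast elim: occurrence_twelve_mesh_obtains)

lemma occurrences_twelve_mesh_max_splits:
  assumes "1 \<le> a" "\<pi> \<in> max_splits a n"
  obtains i where "occurrences twelve_mesh n \<pi> = {{i, Suc a}}"
    "mesh_box n \<pi> {i, Suc a} (2, 1) = {Suc (Suc a)..n}"
proof -
  note s = max_splitsD[OF assms(2)]
  have "a \<in> \<pi> ` {1..a}" using s(4) assms(1) by simp
  then obtain i where i: "i \<in> {1..a}" "\<pi> i = a" by auto
  have "occurrences twelve_mesh n \<pi> = {{i, Suc a}}"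
  proof (intro equalityI subsetI)
    fix I assume "I \<in> occurrences twelve_mesh n \<pi>"
    then obtain i' a' where *: "I = {i', Suc a'}" "\<pi> \<in> max_splits a' n" "\<pi> i' = a'"
      using occurrence_twelve_mesh_obtains[OF s(1)] by metis
    have "a' = a" using max_splits_unique *(2) assms(2) by blast
    then have "i' = i" using *(3) i(2) permutes_inj[OF s(1)] by (auto dest: injD)
    then show "I \<in> {{i, Suc a}}" using * \<open>a' = a\<close> by simp
  next
    fix I assume "I \<in> {{i, Suc a}}"
    then show "I \<in> occurrences twelve_mesh n \<pi>"
      using twelve_mesh_occurrence_iff_max_splits[OF s(1), of i a] i assms by auto
  qed
  moreover have "mesh_box n \<pi> {i, Suc a} (2, 1) = {Suc (Suc a)..n}"
  proof -
    have ij: "i < Suc a" "\<pi> i < \<pi> (Suc a)" using i s by auto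
    have "\<pi> k \<in> {Suc a..<n}" if "k \<in> {Suc (Suc a)..n}" for k
      using that max_splits_image_upper[OF assms(2)] by blast
    moreover have "mesh_box n \<pi> {i, Suc a} (2, 1) =
        {k \<in> {1..n}. Suc a < k \<and> k < Suc n \<and> a < \<pi> k \<and> \<pi> k < n}"
      using gridline_pair[OF ij(1), of n] gridline_pair[OF s(2), of n] i(2) s(3)
      by (simp add: mesh_box_pair numeral_2_eq_2[symmetric])
    ultimately show ?thesis by fastforce
  qed
  ultimately show ?thesis by (rule that)
qed

section \<open>Counting occurrences after the insertion\<close>

lemma is_mesh_pattern_twelve_mesh: "is_mesh_pattern twelve_mesh"
  by (auto simp: is_mesh_pattern_def twelve_mesh_def permutes_id)

lemma mesh_count_insert_twelve_mesh:
  assumes "\<pi> permutes {1..n}" "is_mesh_pattern q"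
  shows "mesh_count (mesh_insert twelve_mesh (2, 1) q) n \<pi> =
    (\<Sum>I\<in>occurrences twelve_mesh n \<pi>. let B = mesh_box n \<pi> I (2, 1)
       in mesh_count q (card B) (standardize \<pi> B))"
proof -
  have "finite (occurrences p n \<sigma>)" for p n \<sigma>
    by (rule finite_subset[of _ "Pow {1..n}"]) (auto simp: occurrences_def)
  moreover have "(2, 1) \<notin> mp_shaded twelve_mesh" "2 \<le> mp_length twelve_mesh" "1 \<le> mp_length twelve_mesh"
    by (auto simp: twelve_mesh_def)
  ultimately show ?thesis
    using bij_betw_same_card[OF bij_betw_occurrences_mesh_insert[OF assms(1)
      is_mesh_pattern_twelve_mesh assms(2), of 2 1]]
    by (simp add: mesh_count_def Let_def)
qed

lemma mesh_count_insert_twelve_mesh_0: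
  assumes "\<pi> permutes {1..n}" "is_mesh_pattern q" "\<And>a. 1 \<le> a \<Longrightarrow> \<pi> \<notin> max_splits a n"
  shows "mesh_count (mesh_insert twelve_mesh (2, 1) q) n \<pi> = 0"
  using occurrences_twelve_mesh_empty[OF assms(1,3)] mesh_count_insert_twelve_mesh[OF assms(1,2)]
  by simp

lemma mesh_count_insert_twelve_mesh_max_splits:
  assumes "is_mesh_pattern q" "1 \<le> a" "\<pi> \<in> max_splits a n"
  shows "mesh_count (mesh_insert twelve_mesh (2, 1) q) n \<pi> =
    mesh_count q (n - Suc a) (standardize \<pi> {Suc (Suc a)..n})"
proof -
  obtain i where "occurrences twelve_mesh n \<pi> = {{i, Suc a}}"
    "mesh_box n \<pi> {i, Suc a} (2, 1) = {Suc (Suc a)..n}"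
    using occurrences_twelve_mesh_max_splits[OF assms(2,3)] .
  then show ?thesis
    using mesh_count_insert_twelve_mesh[OF max_splitsD(1)[OF assms(3)] assms(1)]
    by (simp add: Let_def)
qed

section \<open>Gluing two permutations around the maximum\<close>

text \<open>The one-line notation of \<open>glue a n \<alpha> \<beta>\<close> is \<open>\<alpha> n (\<beta> + a)\<close>.\<close>

definition glue :: "nat \<Rightarrow> nat \<Rightarrow> (nat \<Rightarrow> nat) \<Rightarrow> (nat \<Rightarrow> nat) \<Rightarrow> nat \<Rightarrow> nat" where
  "glue a n \<alpha> \<beta> x = (if x \<le> a then \<alpha> x else if x = Suc a then n
     else if x \<le> n then a + \<beta> (x - Suc a) else x)"

text \<open>
  The part after the maximum has the consecutive values \<open>Suc a, \<dots>, n - 1\<close>, so standardizing it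
  only subtracts \<open>a\<close>.
\<close>

lemma standardize_max_splits:
  assumes "\<pi> \<in> max_splits a n" "x \<in> {1..n - Suc a}"
  shows "standardize \<pi> {Suc (Suc a)..n} x = \<pi> (x + Suc a) - a"
proof -
  have "[Suc (Suc a)..<Suc n] ! (x - 1) = Suc (Suc a) + (x - 1)"
    by (rule nth_upt) (use assms(2) in auto)
  then have nth: "nth_position {Suc (Suc a)..n} x = x + Suc a"
    using assms(2) by (simp add: nth_position_def sorted_list_of_set_range[symmetric]
        atLeastLessThanSuc_atLeastAtMost del: upt_Suc)
  have "\<pi> (x + Suc a) \<in> \<pi> ` {Suc (Suc a)..n}" using assms(2) by auto
  then have "\<pi> (x + Suc a) < n" using max_splits_image_upper[OF assms(1)] by auto
  then have "{w \<in> {Suc a..<n}. w \<le> \<pi> (x + Suc a)} = {Suc a..\<pi> (x + Suc a)}" by auto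
  then show ?thesis
    using assms(2) by (simp add: standardize_def nth max_splits_image_upper[OF assms(1)])
qed

lemma glue_max_splits:
  assumes "a < n" and \<alpha>: "\<alpha> permutes {1..a}" and \<beta>: "\<beta> permutes {1..n - Suc a}"
  shows "glue a n \<alpha> \<beta> \<in> max_splits a n"
proof -
  let ?g = "glue a n \<alpha> \<beta>"
  have A: "\<alpha> x \<in> {1..a}" if "x \<in> {1..a}" for x using \<alpha> that by (simp only: permutes_in_image)
  have B: "\<beta> x \<in> {1..n - Suc a}" if "x \<in> {1..n - Suc a}" for x
    using \<beta> that by (simp only: permutes_in_image)
  have parts: "x \<in> {1..a} \<and> ?g x = \<alpha> x \<and> ?g x \<in> {1..a} \<or> x = Suc a \<and> ?g x = n \<or>
      x - Suc a \<in> {1..n - Suc a} \<and> Suc a < x \<and> ?g x = a + \<beta> (x - Suc a) \<and> ?g x \<in> {Suc a..<n}"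
    if "x \<in> {1..n}" for x
  proof (cases "x \<le> Suc a")
    case True
    then show ?thesis using that A[of x] by (auto simp: glue_def le_Suc_eq)
  next
    case False
    then have "x - Suc a \<in> {1..n - Suc a}" using that by auto
    then show ?thesis using False that B[of "x - Suc a"] by (auto simp: glue_def)
  qed
  have "inj_on ?g {1..n}"
  proof (rule inj_onI)
    fix x y assume xy: "x \<in> {1..n}" "y \<in> {1..n}" "?g x = ?g y"
    have ia: "\<alpha> x = \<alpha> y \<Longrightarrow> x = y" using permutes_inj[OF \<alpha>] by (auto dest: injD)
    have ib: "\<beta> (x - Suc a) = \<beta> (y - Suc a) \<Longrightarrow> x - Suc a = y - Suc a"
      using permutes_inj[OF \<beta>] by (auto dest: injD)
    show "x = y" using parts[OF xy(1)] parts[OF xy(2)] xy(3) ia ib assms(1) by auto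
  qed
  moreover have "?g ` {1..n} \<subseteq> {1..n}"
  proof (rule image_subsetI)
    fix x assume "x \<in> {1..n}"
    then show "?g x \<in> {1..n}" using parts[of x] assms(1) by auto
  qed
  ultimately have "bij_betw ?g {1..n} {1..n}"
    by (simp add: bij_betw_def endo_inj_surj)
  moreover have "?g x = x" if "x \<notin> {1..n}" for x
    using that assms(1) permutes_not_in[OF \<alpha>, of x] by (auto simp: glue_def)
  ultimately have "?g permutes {1..n}" by (rule bij_imp_permutes)
  moreover have "?g ` {1..a} = \<alpha> ` {1..a}" by (rule image_cong) (auto simp: glue_def)
  ultimately show ?thesis
    using assms(1) permutes_image[OF \<alpha>] by (simp add: max_splits_def glue_def)
qed

lemma standardize_glue:
  assumes "a < n" "\<alpha> permutes {1..a}" and \<beta>: "\<beta> permutes {1..n - Suc a}"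
  shows "standardize (glue a n \<alpha> \<beta>) {Suc (Suc a)..n} = \<beta>"
proof
  fix x
  show "standardize (glue a n \<alpha> \<beta>) {Suc (Suc a)..n} x = \<beta> x"
  proof (cases "x \<in> {1..n - Suc a}")
    case True
    then show ?thesis
      using standardize_max_splits[OF glue_max_splits[OF assms] True] by (auto simp: glue_def)
  next
    case False
    then show ?thesis using permutes_not_in[OF \<beta>] by (auto simp: standardize_def)
  qed
qed

text \<open>
  The inverse takes \<open>\<pi>\<close> to its restriction to \<open>{1..a}\<close> (the identity elsewhere) and to the
  standardization of the part after the maximum.
\<close>

lemma bij_betw_glue:
  assumes "a < n"
  shows "bij_betw (\<lambda>(\<alpha>, \<beta>). glue a n \<alpha> \<beta>)
    ({\<alpha>. \<alpha> permutes {1..a}} \<times> {\<beta>. \<beta> permutes {1..n - Suc a}}) (max_splits a n)"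
proof -
  let ?P = "{\<alpha>. \<alpha> permutes {1..a}} \<times> {\<beta>. \<beta> permutes {1..n - Suc a}}"
  let ?lower = "\<lambda>\<pi> x. if x \<in> {1..a} then \<pi> x else x"
  let ?upper = "\<lambda>\<pi>. standardize \<pi> {Suc (Suc a)..n}"
  have perm: "?lower \<pi> permutes {1..a}" "?upper \<pi> permutes {1..n - Suc a}"
    if "\<pi> \<in> max_splits a n" for \<pi>
  proof -
    note s = max_splitsD[OF that]
    have "bij_betw \<pi> {1..a} {1..a}"
      using s(4) permutes_inj[OF s(1)] by (auto simp: bij_betw_def intro: inj_on_subset)
    then have "bij_betw (?lower \<pi>) {1..a} {1..a}" by (rule bij_betw_cong[THEN iffD1, rotated]) auto
    then show "?lower \<pi> permutes {1..a}" by (rule bij_imp_permutes) auto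
    show "?upper \<pi> permutes {1..n - Suc a}"
      using standardize_permutes[of "{Suc (Suc a)..n}" \<pi>] permutes_inj[OF s(1)]
      by (simp add: inj_on_subset)
  qed
  have "glue a n (?lower \<pi>) (?upper \<pi>) = \<pi>" if "\<pi> \<in> max_splits a n" for \<pi>
  proof
    fix x
    note s = max_splitsD[OF that]
    consider "x = 0" | "x \<in> {1..a}" | "x = Suc a" | "x \<in> {Suc (Suc a)..n}" | "x > n" "x > Suc a"
      using assms by fastforce
    then show "glue a n (?lower \<pi>) (?upper \<pi>) x = \<pi> x"
    proof cases
      case 4
      then have "\<pi> x \<in> {Suc a..<n}" using max_splits_image_upper[OF that] by blast
      moreover have "?upper \<pi> (x - Suc a) = \<pi> x - a"
        using standardize_max_splits[OF that, of "x - Suc a"] 4 by (simp add: Suc_le_eq diff_le_mono)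
      ultimately show ?thesis using 4 by (auto simp: glue_def)
    qed (use s permutes_not_in[OF s(1), of x] in \<open>auto simp: glue_def\<close>)
  qed
  moreover have "?lower (glue a n \<alpha> \<beta>) = \<alpha>" if "\<alpha> permutes {1..a}" for \<alpha> \<beta>
    using permutes_not_in[OF that] by (auto simp: glue_def fun_eq_iff)
  ultimately show ?thesis
    using perm standardize_glue[OF assms] glue_max_splits[OF assms]
    by (intro bij_betw_byWitness[of _ "\<lambda>\<pi>. (?lower \<pi>, ?upper \<pi>)"]) auto
qed

text \<open>
  A statistic that only depends on the part after the maximum is summed over the fibres of the
  bijection, each of which has \<open>a!\<close> elements, one for each choice of the part before it.
\<close>

lemma sum_max_splits:
  fixes f :: "(nat \<Rightarrow> nat) \<Rightarrow> 'a::{comm_semiring_1, semiring_char_0}"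
  assumes "a < n"
  shows "(\<Sum>\<pi>\<in>max_splits a n. f (standardize \<pi> {Suc (Suc a)..n})) =
    fact a * (\<Sum>\<beta> | \<beta> permutes {1..n - Suc a}. f \<beta>)"
proof -
  let ?A = "{\<alpha>. \<alpha> permutes {1..a}}" and ?B = "{\<beta>. \<beta> permutes {1..n - Suc a}}"
  have "(\<Sum>\<pi>\<in>max_splits a n. f (standardize \<pi> {Suc (Suc a)..n})) =
      (\<Sum>(\<alpha>, \<beta>)\<in>?A \<times> ?B. f (standardize (glue a n \<alpha> \<beta>) {Suc (Suc a)..n}))"
    by (subst sum.reindex_bij_betw[OF bij_betw_glue[OF assms], symmetric])
      (simp add: case_prod_unfold)
  also have "\<dots> = (\<Sum>(\<alpha>, \<beta>)\<in>?A \<times> ?B. f \<beta>)"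
    by (rule sum.cong) (auto simp: standardize_glue[OF assms])
  also have "\<dots> = fact a * (\<Sum>\<beta>\<in>?B. f \<beta>)"
    by (simp add: sum.cartesian_product[symmetric] card_permutations)
  finally show ?thesis .
qed

section \<open>The generating functions\<close>

unbundle fps_syntax

text \<open>
  Subtracting \<open>F\<close> turns the weight \<open>q\<^bsup>p(\<pi>)\<^esup>\<close> into \<open>q\<^bsup>p(\<pi>)\<^esup> - 1\<close>, which vanishes on
  all permutations without an occurrence of the base pattern.  The others are partitioned by the
  length \<open>a \<ge> 1\<close> of the part before the maximum.  In the product, \<open>F - 1\<close> enumerates this
  nonempty part, \<open>x\<close> stands for the maximum and the last factor
  for the rest.
\<close>

lemma F_pat_insert_twelve_mesh:
  assumes q: "is_mesh_pattern q"
  shows "F_pat (mesh_insert twelve_mesh (2, 1) q) =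
    F_series + fps_X * (F_series - 1) * (F_pat q - F_series)"
proof (rule fps_ext)
  fix n
  let ?p = "mesh_insert twelve_mesh (2, 1) q"
  let ?S = "\<lambda>n::nat. {\<pi>. \<pi> permutes {1..n}}"
  define w where "w = (\<lambda>n \<pi>. monom 1 (mesh_count ?p n \<pi>) - (1 :: int poly))"
  define u where "u = (\<lambda>n \<rho>. monom 1 (mesh_count q n \<rho>) - (1 :: int poly))"
  have fin: "finite (?S n)" for n by (rule finite_permutations) simp
  have u: "(F_pat q - F_series) $ n = (\<Sum>\<rho>\<in>?S n. u n \<rho>)" for n
    by (simp add: F_pat_def F_series_def u_def sum_subtractf card_permutations)
  have G: "(F_series - 1 :: int poly fps) $ a = (if a = 0 then 0 else fact a)" for a
    by (simp add: F_series_def)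
  have "F_pat ?p $ n - F_series $ n = (\<Sum>\<pi>\<in>?S n. w n \<pi>)"
    by (simp add: F_pat_def F_series_def w_def sum_subtractf card_permutations)
  also have "\<dots> = (\<Sum>\<pi>\<in>(\<Union>a\<in>{1..<n}. max_splits a n). w n \<pi>)"
  proof (rule sum.mono_neutral_right[OF fin])
    show "(\<Union>a\<in>{1..<n}. max_splits a n) \<subseteq> ?S n" by (auto dest: max_splitsD)
    show "\<forall>\<pi>\<in>?S n - (\<Union>a\<in>{1..<n}. max_splits a n). w n \<pi> = 0"
    proof
      fix \<pi> assume \<pi>: "\<pi> \<in> ?S n - (\<Union>a\<in>{1..<n}. max_splits a n)"
      then have "\<pi> \<notin> max_splits a n" if "1 \<le> a" for a
        using that max_splitsD(2)[of \<pi> a n] by auto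
      then show "w n \<pi> = 0"
        using mesh_count_insert_twelve_mesh_0[OF _ q] \<pi> by (simp add: w_def)
    qed
  qed
  also have "\<dots> = (\<Sum>a\<in>{1..<n}. \<Sum>\<pi>\<in>max_splits a n. w n \<pi>)"
  proof (rule sum.UNION_disjoint)
    show "\<forall>a\<in>{1..<n}. finite (max_splits a n)"
      using fin by (auto simp: max_splits_def intro: finite_subset)
  qed (use max_splits_unique in auto)
  also have "\<dots> = (\<Sum>a\<in>{1..<n}. fact a * (\<Sum>\<rho>\<in>?S (n - Suc a). u (n - Suc a) \<rho>))"
  proof (rule sum.cong[OF refl])
    fix a assume a: "a \<in> {1..<n}"
    have "(\<Sum>\<pi>\<in>max_splits a n. w n \<pi>) =
        (\<Sum>\<pi>\<in>max_splits a n. u (n - Suc a) (standardize \<pi> {Suc (Suc a)..n}))"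
      using a mesh_count_insert_twelve_mesh_max_splits[OF q]
      by (intro sum.cong) (auto simp: w_def u_def)
    then show "(\<Sum>\<pi>\<in>max_splits a n. w n \<pi>) =
        fact a * (\<Sum>\<rho>\<in>?S (n - Suc a). u (n - Suc a) \<rho>)"
      using sum_max_splits[of a n "u (n - Suc a)"] a by simp
  qed
  also have "\<dots> = (fps_X * (F_series - 1) * (F_pat q - F_series)) $ n"
  proof (cases n)
    case (Suc m)
    have "(fps_X * (F_series - 1) * (F_pat q - F_series)) $ n =
        (\<Sum>a=0..m. (F_series - 1) $ a * (F_pat q - F_series) $ (m - a))"
      by (simp add: Suc mult.assoc fps_mult_nth[of "F_series - 1"])
    also have "\<dots> = (\<Sum>a\<in>{1..<n}. (F_series - 1) $ a * (F_pat q - F_series) $ (m - a))"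
      by (rule sum.mono_neutral_right) (auto simp: Suc G simp del: fps_sub_nth)
    also have "\<dots> = (\<Sum>a\<in>{1..<n}. fact a * (\<Sum>\<rho>\<in>?S (n - Suc a). u (n - Suc a) \<rho>))"
      by (rule sum.cong[OF refl]) (simp add: Suc G u del: fps_sub_nth)
    finally show ?thesis by simp
  qed (simp add: mult.assoc)
  finally show "F_pat ?p $ n = (F_series + fps_X * (F_series - 1) * (F_pat q - F_series)) $ n"
    by (simp add: algebra_simps)
qed

text \<open>
  The substitution \<open>q = 0\<close>, a ring homomorphism.  It turns \<open>q\<^bsup>p(\<pi>)\<^esup>\<close> into 1 if \<open>\<pi>\<close>
  avoids \<open>p\<close> and into 0 otherwise.
\<close>

definition eval_zero :: "int poly fps \<Rightarrow> int fps" where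
  "eval_zero f = Abs_fps (\<lambda>n. poly (f $ n) 0)"

lemma eval_zero_ring_ops:
  "eval_zero (f + g) = eval_zero f + eval_zero g"
  "eval_zero (f - g) = eval_zero f - eval_zero g"
  "eval_zero (f * g) = eval_zero f * eval_zero g"
  "eval_zero 1 = 1"
  "eval_zero fps_X = fps_X"
  by (auto simp: eval_zero_def fps_eq_iff fps_mult_nth poly_sum fps_X_def)

lemma eval_zero_F_series: "eval_zero F_series = F_series"
proof -
  have "poly (fact n :: int poly) 0 = fact n" for n
    by (metis of_nat_fact poly_of_nat)
  then show ?thesis by (simp add: eval_zero_def F_series_def fps_eq_iff)
qed

lemma eval_zero_F_pat: "eval_zero (F_pat p) = A_pat p"
proof (rule fps_ext)
  fix n
  have "poly (monom (1::int) k) 0 = (if k = 0 then 1 else 0)" for k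
    by (simp add: poly_monom)
  then show "eval_zero (F_pat p) $ n = A_pat p $ n"
    by (simp add: eval_zero_def F_pat_def A_pat_def poly_sum sum.If_cases finite_permutations
        Collect_conj_eq)
qed

theorem theorem3p2:
  fixes p p1 :: mesh_pattern
  assumes "is_mesh_pattern p1"
    and "p = mesh_insert (Mesh 2 id {(0,1), (0,2), (1,1), (1,2), (2,0), (2,2)}) (2, 1) p1"
  shows "A_pat p = F_series - fps_X * (F_series - 1) * (F_series - A_pat p1) \<and>
    F_pat p = F_series + fps_X * (F_series - 1) * (F_pat p1 - F_series)"
proof
  show F: "F_pat p = F_series + fps_X * (F_series - 1) * (F_pat p1 - F_series)"
    using F_pat_insert_twelve_mesh[OF assms(1)] assms(2) by (simp add: twelve_mesh_def)
  have "A_pat p = F_series + fps_X * (F_series - 1) * (A_pat p1 - F_series)"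
    using arg_cong[OF F, of eval_zero]
    by (simp add: eval_zero_ring_ops eval_zero_F_series eval_zero_F_pat)
  then show "A_pat p = F_series - fps_X * (F_series - 1) * (F_series - A_pat p1)"
    by (simp add: algebra_simps)
qed

end
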